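(* Let $(F,\ell_F)\in\mathcal{G}_{or(n)}$, $g\in\mathfrak{S}$, and $\mu\in S_n$. Then the following are equivalent: 1. There is a graph $(H,\ell_H)\in Orb(F,\ell_F)$ that is self-$(g,g,\dots,g)$ via the permutation $\mu$ (i.e. $(H,\ell_H)$ is self-dual, -Petrial, -Wilsonial, or -trial, according to $g$). 2. Every graph $(G,\ell_G)\in Orb(F,\ell_F)$ is self-$\hat\gamma'$ via $\mu'$ for some $\hat\gamma'=(\xi_1,\xi_2,\dots,\xi_n)\in\mathfrak{S}^n$ and some $\mu'=\pi\mu\pi^{-1}$ with $\pi\in S_n$, where $\hat\gamma'$ has the property that if $C=(c_1,c_2,\dots,c_m)$ is a cycle in the cycle decomposition of $\mu'$, then $\operatorname{ord}\left(\xi_{c_m}\xi_{c_{m-1}}\cdots\xi_{c_1}\right)=\operatorname{ord}(g^m)$. 3. There exists a graph $(G,\ell_G)\in Orb(F,\ell_F)$ that is self-$\hat\gamma'$ via $\mu'$ for some $\hat\gamma'=(\xi_1,\xi_2,\dots,\xi_n)\in\mathfrak{S}^n$ and some $\mu'=\pi\mu\pi^{-1}$ with $\pi\in S_n$, where $\hat\gamma'$ has the property that if $C=(c_1,c_2,\dots,c_m)$ is a cycle in the cycle decomposition of $\mu'$, then $\operatorname{ord}\left(\xi_{c_m}\xi_{c_{m-1}}\cdots\xi_{c_1}\right)=\operatorname{ord}(g^m)$.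
   Context: **Ribbon graphs.** A (finite) ribbon graph $G=(V(G),E(G))$ is a surface with boundary presented as the union of a set $V(G)$ of discs (vertices) and a set $E(G)$ of discs (edges) such that vertices and edges intersect in disjoint line segments, each such segment lies on the boundary of precisely one vertex and precisely one edge, and every edge contains exactly two such segments. Two ribbon graphs are isomorphic if there is a homeomorphism (not required to preserve any orientation) taking vertices to vertices and edges to edges; equivalently, if the corresponding cellularly embedded graphs are isomorphic. **Arrow presentations.** A ribbon graph is encoded by drawing each vertex boundary as a circle and recording, for each edge $e$, two directed arcs (arrows) labelled $e$ on the circles, namely the two segments where $e$ meets vertices, directed by an arbitrary orientation of the boundary of the disc $e$. **Operations on one edge.** Let $A,B$ be the two arrows labelled $e$. The partial Petrial (twist) $\tau$ at $e$ reverses the direction of exactly one of $A,B$. The partial dual $\delta$ at $e$: draw a segment with an arrow on it labelled $e$ directed from the head of $A$ to the tail of $B$, and another with an arrow labelled $e$ directed from the head of $B$ to the tail of $A$; then delete $A$, $B$ and the arcs containing them. Vertices may change; the set of edges (labels) is unchanged. It is known that the group $\mathfrak{S} = \langle \delta,\tau \mid \delta^2,\tau^2,(\tau\delta)^3\rangle \cong S_3$ thereby acts on the left on any fixed edge (in a product the rightmost factor is applied first), and operations on distinct edges commute. **Ordered graphs.** $[n]=\{1,\dots,n\}$. $\mathcal{G}_{or(n)}$ is the set of isomorphism classes of pairs $(G,\ell)$, where $G$ is a ribbon graph with exactly $n$ edges ($n\ge 1$) and $\ell\colon[n]\to E(G)$ is a bijection (a linear ordering of the edges). $(G,\ell_G)$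 and $(H,\ell_H)$ are isomorphic if there is a ribbon graph isomorphism $G\to H$ whose edge bijection $g$ satisfies $g\circ\ell_G=\ell_H$. "Graph" means an element of $\mathcal{G}_{or(n)}$. **Group action.** An element $\hat\gamma\in\mathfrak{S}^n$ is regarded as a map $[n]\to\mathfrak{S}$; multiplication and inversion in $\mathfrak{S}^n$ are entrywise, and $\hat\gamma\pi$, for $\pi\in S_n$, is composition of maps. $G^{\Gamma(\hat\gamma,\ell)}$ denotes the ribbon graph obtained from $G$ by applying to each edge $e$ the operation $\hat\gamma(\ell^{-1}(e))$. The group $\mathfrak{S}^n\rtimes S_n$, with multiplication $(\hat\gamma_1,\pi_1)(\hat\gamma_2,\pi_2)=(\hat\gamma_1\cdot\hat\gamma_2\pi_1^{-1},\pi_1\pi_2)$, acts on $\mathcal{G}_{or(n)}$ by $(\hat\gamma,\pi)(G,\ell)=(G^{\Gamma(\hat\gamma,\ell\pi^{-1})},\ell\pi^{-1})$. $Orb(F,\ell_F)$ is the orbit of $(F,\ell_F)$ under $\mathfrak{S}^n\rtimes S_n$. **Self-$\hat\gamma$.** $(G,\ell)$ is self-$\hat\gamma$ via $\mu\in S_n$ if $(\hat\gamma,\mu)(G,\ell)=(G,\ell)$ in $\mathcal{G}_{or(n)}$. For uniform $\hat\gamma=(g,\dots,g)$ this is called self-dual ($g=\delta$), self-Petrial ($g=\tau$), self-Wilsonial ($g=\tau\delta\tau$), self-trial ($g=\delta\tau$ or $\tau\delta$). **Conventions.** $\operatorname{ord}$ is the order of an element of $\mathfrak{S}$. A cycle $(c_1,\dots,c_m)$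 of $\mu'$ means $\mu'(c_i)=c_{i+1}$ with indices mod $m$; cycle decompositions include fixed points as cycles of length $1$. *)

theory Defs
  imports "HOL-Algebra.Algebra"
begin

text \<open>The group presented by generators \<open>\<delta>, \<tau>\<close> and relators
  \<open>\<delta>\<^sup>2, \<tau>\<^sup>2, (\<tau>\<delta>)\<^sup>3\<close>.  As the generators are involutions, words without
  formal inverses suffice.  The word \<open>[x\<^sub>1, \<dots>, x\<^sub>k]\<close> stands for the product
  \<open>x\<^sub>1 \<cdots> x\<^sub>k\<close>.\<close>

datatype generator = Delta | Tau

definition relators :: "generator list set" where
  "relators = {[Delta, Delta], [Tau, Tau], [Tau, Delta, Tau, Delta, Tau, Delta]}"

inductive word_eq :: "generator list \<Rightarrow> generator list \<Rightarrow> bool" where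
  refl: "word_eq u u"
| sym: "word_eq u v \<Longrightarrow> word_eq v u"
| trans: "word_eq u v \<Longrightarrow> word_eq v w \<Longrightarrow> word_eq u w"
| cancel: "r \<in> relators \<Longrightarrow> word_eq (u @ r @ v) (u @ v)"

lemma equivp_word_eq: "equivp word_eq"
  by (intro equivpI reflpI sympI transpI) (blast intro: word_eq.intros)+

quotient_type ribbon_op = "generator list" / word_eq
  by (rule equivp_word_eq)

lemma word_eq_append_left: "word_eq u v \<Longrightarrow> word_eq (w @ u) (w @ v)"
proof (induction rule: word_eq.induct)
  case (cancel r u v)
  then show ?case using word_eq.cancel[of r "w @ u" v] by simp
qed (blast intro: word_eq.intros)+

lemma word_eq_append_right: "word_eq u v \<Longrightarrow> word_eq (u @ w) (v @ w)"
proof (induction rule: word_eq.induct)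
  case (cancel r u v)
  then show ?case using word_eq.cancel[of r u "v @ w"] by simp
qed (blast intro: word_eq.intros)+

lift_definition ribbon_op_mult :: "ribbon_op \<Rightarrow> ribbon_op \<Rightarrow> ribbon_op" is append
  by (blast intro: word_eq.trans word_eq_append_left word_eq_append_right)

lift_definition ribbon_op_one :: ribbon_op is "[]" .

definition ribbon_group_ops :: "ribbon_op monoid" (\<open>\<SS>\<close>) where
  "\<SS> = \<lparr>carrier = UNIV, monoid.mult = ribbon_op_mult, one = ribbon_op_one\<rparr>"

lemma word_eq_rev_cancel: "word_eq (rev u @ u) []"
proof (induction u)
  case (Cons x u)
  have "[x, x] \<in> relators" by (cases x) (auto simp: relators_def)
  from word_eq.cancel[OF this, of "rev u" u] Cons show ?case
    by (auto intro: word_eq.trans)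
qed (auto intro: word_eq.refl)

lemma group_ribbon_ops: "group \<SS>"
proof (rule groupI)
  fix x y z :: ribbon_op
  show "x \<otimes>\<^bsub>\<SS>\<^esub> y \<otimes>\<^bsub>\<SS>\<^esub> z = x \<otimes>\<^bsub>\<SS>\<^esub> (y \<otimes>\<^bsub>\<SS>\<^esub> z)"
    unfolding ribbon_group_ops_def by (simp, transfer) (simp add: word_eq.refl)
  show "\<one>\<^bsub>\<SS>\<^esub> \<otimes>\<^bsub>\<SS>\<^esub> x = x"
    unfolding ribbon_group_ops_def by (simp, transfer) (simp add: word_eq.refl)
  have "\<exists>y. ribbon_op_mult y x = ribbon_op_one"
    by transfer (blast intro: word_eq_rev_cancel)
  then show "\<exists>y\<in>carrier \<SS>. y \<otimes>\<^bsub>\<SS>\<^esub> x = \<one>\<^bsub>\<SS>\<^esub>"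
    by (simp add: ribbon_group_ops_def)
qed (auto simp: ribbon_group_ops_def)

text \<open>The two arrows labelled by an edge are called \<open>ArrA\<close> and \<open>ArrB\<close>; these names and the
  choice of direction are forgotten by \<open>ribbon_iso\<close> below.  The vertex circles are cut at
  the ends of the arrows into the arrows themselves and the complementary arcs; \<open>arc G\<close>
  is the involution that exchanges the two ends of each complementary arc.  So the circles carrying
  arrows are the components of the 2-regular graph on the ends of arrows whose edges are the
  arrows and the complementary arcs.  Circles without arrows, that is isolated vertices,
  are counted by \<open>isolated G\<close>.\<close>

datatype arrow = ArrA | ArrB
datatype tip = Tail | Head

type_synonym 'e arrow_end = "'e \<times> arrow \<times> tip"

record 'e ribbon_graph =
  edges :: "'e set"
  arc :: "'e arrow_end \<Rightarrow> 'e arrow_end"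
  isolated :: nat

definition arrow_ends :: "'e ribbon_graph \<Rightarrow> 'e arrow_end set" where
  "arrow_ends G = edges G \<times> UNIV"

definition is_ribbon_graph :: "'e ribbon_graph \<Rightarrow> bool" where
  "is_ribbon_graph G \<longleftrightarrow> finite (edges G) \<and>
     (\<forall>p\<in>arrow_ends G. arc G p \<in> arrow_ends G \<and> arc G p \<noteq> p \<and> arc G (arc G p) = p)"

fun other_arrow :: "arrow \<Rightarrow> arrow" where
  "other_arrow ArrA = ArrB"
| "other_arrow ArrB = ArrA"

fun other_tip :: "tip \<Rightarrow> tip" where
  "other_tip Tail = Head"
| "other_tip Head = Tail"

text \<open>A homeomorphism of edge discs matches the two segments in one of two ways, and
  either preserves or reverses the chosen orientation of the boundary of the disc, hence
  the direction of both arrows.\<close>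

fun arrow_sym :: "bool \<Rightarrow> bool \<Rightarrow> arrow \<times> tip \<Rightarrow> arrow \<times> tip" where
  "arrow_sym s r (x, y) = (if s then other_arrow x else x, if r then other_tip y else y)"

definition ribbon_iso :: "('e \<Rightarrow> 'e) \<Rightarrow> 'e ribbon_graph \<Rightarrow> 'e ribbon_graph \<Rightarrow> bool" where
  "ribbon_iso h G H \<longleftrightarrow> bij_betw h (edges G) (edges H) \<and> isolated G = isolated H \<and>
     (\<exists>s r. let \<phi> = (\<lambda>(e, p). (h e, arrow_sym (s e) (r e) p))
            in \<forall>p\<in>arrow_ends G. arc H (\<phi> p) = \<phi> (arc G p))"

text \<open>Both operations keep all ends of arrows and all complementary arcs in place, and
  only replace the arrows joining the ends.  They are given by the new name of each end:
  \<open>\<tau>\<close> reverses \<open>ArrA\<close>; for \<open>\<delta>\<close>, the new \<open>ArrA\<close> runs from the head of the old \<open>ArrA\<close> to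
  the tail of the old \<open>ArrB\<close>, and the new \<open>ArrB\<close> from the head of the old \<open>ArrB\<close> to the
  tail of the old \<open>ArrA\<close>.\<close>

fun new_name :: "generator \<Rightarrow> arrow \<times> tip \<Rightarrow> arrow \<times> tip" where
  "new_name Tau (ArrA, Tail) = (ArrA, Head)"
| "new_name Tau (ArrA, Head) = (ArrA, Tail)"
| "new_name Tau (ArrB, y) = (ArrB, y)"
| "new_name Delta (ArrA, Head) = (ArrA, Tail)"
| "new_name Delta (ArrB, Tail) = (ArrA, Head)"
| "new_name Delta (ArrB, Head) = (ArrB, Tail)"
| "new_name Delta (ArrA, Tail) = (ArrB, Head)"

definition rename_at :: "'e \<Rightarrow> (arrow \<times> tip \<Rightarrow> arrow \<times> tip) \<Rightarrow> 'e arrow_end \<Rightarrow> 'e arrow_end" where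
  "rename_at e f = (\<lambda>(e', p). (e', if e' = e then f p else p))"

definition apply_generator :: "'e \<Rightarrow> generator \<Rightarrow> 'e ribbon_graph \<Rightarrow> 'e ribbon_graph" where
  "apply_generator e x G =
     (let \<rho> = rename_at e (new_name x) in G\<lparr>arc := \<rho> \<circ> arc G \<circ> inv' \<rho>\<rparr>)"

text \<open>The rightmost letter acts first.\<close>

definition apply_word :: "'e \<Rightarrow> generator list \<Rightarrow> 'e ribbon_graph \<Rightarrow> 'e ribbon_graph" where
  "apply_word e w = foldr (apply_generator e) w"

text \<open>Up to isomorphism the word chosen by \<open>rep_ribbon_op\<close> is immaterial.\<close>

definition apply_op :: "'e \<Rightarrow> ribbon_op \<Rightarrow> 'e ribbon_graph \<Rightarrow> 'e ribbon_graph" where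
  "apply_op e \<xi> = apply_word e (rep_ribbon_op \<xi>)"

type_synonym 'e ordered_graph = "'e ribbon_graph \<times> (nat \<Rightarrow> 'e)"

definition ordered_graphs :: "nat \<Rightarrow> 'e ordered_graph set" where
  "ordered_graphs n = {(G, l). is_ribbon_graph G \<and> card (edges G) = n \<and> bij_betw l {1..n} (edges G)}"

definition ordered_iso :: "nat \<Rightarrow> ('e ordered_graph \<times> 'e ordered_graph) set" where
  "ordered_iso n = {((G, lG), (H, lH)). (G, lG) \<in> ordered_graphs n \<and> (H, lH) \<in> ordered_graphs n \<and>
     (\<exists>h. ribbon_iso h G H \<and> (\<forall>i\<in>{1..n}. h (lG i) = lH i))}"

definition \<G>or :: "nat \<Rightarrow> 'e ordered_graph set set" where
  "\<G>or n = ordered_graphs n // ordered_iso n"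

text \<open>\<open>G\<^bsup>\<Gamma>(\<gamma>,l)\<^esup>\<close>; the operations on distinct edges commute, so the order is immaterial.\<close>

definition apply_all :: "nat \<Rightarrow> (nat \<Rightarrow> ribbon_op) \<Rightarrow> (nat \<Rightarrow> 'e) \<Rightarrow> 'e ribbon_graph \<Rightarrow> 'e ribbon_graph" where
  "apply_all n \<gamma> l G = fold (\<lambda>i. apply_op (l i) (\<gamma> i)) [1..<Suc n] G"

abbreviation ops_power :: "nat \<Rightarrow> (nat \<Rightarrow> ribbon_op) monoid" where
  "ops_power n \<equiv> product_group {1..n} (\<lambda>_. \<SS>)"

definition semidirect :: "nat \<Rightarrow> ((nat \<Rightarrow> ribbon_op) \<times> (nat \<Rightarrow> nat)) monoid" where
  "semidirect n = \<lparr>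
     carrier = carrier (ops_power n) \<times> carrier (sym_group n),
     monoid.mult = (\<lambda>(\<gamma>\<^sub>1, \<pi>\<^sub>1) (\<gamma>\<^sub>2, \<pi>\<^sub>2). (\<gamma>\<^sub>1 \<otimes>\<^bsub>ops_power n\<^esub> (\<gamma>\<^sub>2 \<circ> inv' \<pi>\<^sub>1), \<pi>\<^sub>1 \<circ> \<pi>\<^sub>2)),
     one = (\<one>\<^bsub>ops_power n\<^esub>, id)\<rparr>"

fun act_graph :: "nat \<Rightarrow> (nat \<Rightarrow> ribbon_op) \<times> (nat \<Rightarrow> nat) \<Rightarrow> 'e ordered_graph \<Rightarrow> 'e ordered_graph" where
  "act_graph n (\<gamma>, \<pi>) (G, l) = (apply_all n \<gamma> (l \<circ> inv' \<pi>) G, l \<circ> inv' \<pi>)"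

definition act :: "nat \<Rightarrow> (nat \<Rightarrow> ribbon_op) \<times> (nat \<Rightarrow> nat) \<Rightarrow>
    'e ordered_graph set \<Rightarrow> 'e ordered_graph set" where
  "act n a = (\<lambda>C\<in>\<G>or n. \<Union>x\<in>C. ordered_iso n `` {act_graph n a x})"

definition Orb :: "nat \<Rightarrow> 'e ordered_graph set \<Rightarrow> 'e ordered_graph set set" where
  "Orb n C = orbit (semidirect n) (act n) C"

definition self_via :: "nat \<Rightarrow> (nat \<Rightarrow> ribbon_op) \<Rightarrow> (nat \<Rightarrow> nat) \<Rightarrow> 'e ordered_graph set \<Rightarrow> bool" where
  "self_via n \<gamma> \<mu> C \<longleftrightarrow> act n (\<gamma>, \<mu>) C = C"

definition is_cycle_of :: "nat \<Rightarrow> (nat \<Rightarrow> nat) \<Rightarrow> nat list \<Rightarrow> bool" where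
  "is_cycle_of n \<mu> c \<longleftrightarrow> c \<noteq> [] \<and> distinct c \<and> set c \<subseteq> {1..n} \<and>
     (\<forall>i<length c. \<mu> (c ! i) = c ! (Suc i mod length c))"

definition reverse_product :: "(nat \<Rightarrow> ribbon_op) \<Rightarrow> nat list \<Rightarrow> ribbon_op" where
  "reverse_product \<xi> c = foldr (\<otimes>\<^bsub>\<SS>\<^esub>) (map \<xi> (rev c)) \<one>\<^bsub>\<SS>\<^esub>"

definition cycle_ord_property :: "nat \<Rightarrow> ribbon_op \<Rightarrow> (nat \<Rightarrow> ribbon_op) \<Rightarrow> (nat \<Rightarrow> nat) \<Rightarrow> bool" where
  "cycle_ord_property n g \<xi> \<mu> \<longleftrightarrow> (\<forall>c. is_cycle_of n \<mu> c \<longrightarrow>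
     group.ord \<SS> (reverse_product \<xi> c) = group.ord \<SS> (g [^]\<^bsub>\<SS>\<^esub> length c))"

end

theory Submission
  imports Defs
begin

text \<open>
  The theorem is a statement about conjugation in \<open>A = \<SS>\<^sup>n \<rtimes> S\<^sub>n\<close>, once \<open>A\<close> is known to act on
  isomorphism classes of ordered graphs (\<open>group_action_act\<close>).  A point \<open>H\<close> is fixed by \<open>b\<close> exactly
  if \<open>a H\<close> is fixed by \<open>a b a\<^sup>-\<^sup>1\<close>.  So a self-\<open>(g, \<dots>, g)\<close> graph via \<open>\<mu>\<close> in the orbit makes every graph
  of the orbit self-\<open>\<xi>\<close> via \<open>\<mu>'\<close> for some conjugate \<open>(\<xi>, \<mu>')\<close> of \<open>((g, \<dots>, g), \<mu>)\<close>, and conversely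
  one graph with such a symmetry leads back to a self-\<open>(g, \<dots>, g)\<close> graph.  Conjugating by
  \<open>(\<gamma>, \<pi>)\<close> gives \<open>\<mu>' = \<pi> \<mu> \<pi>\<^sup>-\<^sup>1\<close> and \<open>\<xi>(\<mu>' i) = \<gamma>(\<mu>' i) g \<gamma>(i)\<^sup>-\<^sup>1\<close>.

  It remains to see which \<open>\<xi>\<close> have this form for some \<open>\<gamma>\<close>.  Around a cycle of length \<open>m\<close> of \<open>\<mu>'\<close> the
  product of the \<open>\<xi>\<close> telescopes to a conjugate of \<open>g\<^sup>m\<close>, so it has the order of \<open>g\<^sup>m\<close>
  (\<open>cycle_ord_if_intertwines\<close>).  Conversely, in \<open>\<SS>\<close> elements of equal order are conjugate
  (\<open>conjugate_if_same_ord\<close>), and a conjugating element for each cycle is all that is needed to solve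
  for \<open>\<gamma>\<close> step by step along the cycle (\<open>intertwines_if_cycle_ord\<close>).

  That \<open>A\<close> acts rests on one fact about four points.  An operation at an edge renames its
  four arrow ends, and isomorphisms may rename them by the Klein four group of symmetries of the edge
  disc.  The Klein group is normal in the symmetric group (\<open>Klein_normal\<close>), and the relators of \<open>\<SS>\<close>
  rename by elements of it (\<open>word_perm_cong\<close>).  So operations, compositions of operations and the choice
  of words for group elements are all well defined up to isomorphism (\<open>ordered_iso_relabel\<close>).
\<close>

section \<open>Renaming the four ends of an edge\<close>

text \<open>The symmetries of an edge disc act on its four arrow ends as the Klein four group of
  translations.  They are exactly the ambiguity that \<^const>\<open>ribbon_iso\<close> allows on each edge.\<close>

definition Klein :: "(arrow \<times> tip \<Rightarrow> arrow \<times> tip) set" where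
  "Klein = range (\<lambda>(s, r). arrow_sym s r)"

lemma arrow_sym_in_Klein: "arrow_sym s r \<in> Klein"
  by (force simp: Klein_def)

lemma all_ends:
  "(\<forall>p. P p) \<longleftrightarrow> P (ArrA, Tail) \<and> P (ArrA, Head) \<and> P (ArrB, Tail) \<and> P (ArrB, Head)"
proof -
  have "(\<forall>x. Q x) \<longleftrightarrow> Q ArrA \<and> Q ArrB" for Q by (metis arrow.exhaust)
  moreover have "(\<forall>y. Q y) \<longleftrightarrow> Q Tail \<and> Q Head" for Q by (metis tip.exhaust)
  ultimately show ?thesis by auto
qed

text \<open>On four points, an involution without fixed points is a product of two disjoint
  transpositions, and there are only three of these.  This description is visibly invariant under
  conjugation, which is what makes normality immediate.\<close>

lemma Klein_iff: "v \<in> Klein \<longleftrightarrow> (\<forall>p. v (v p) = p) \<and> (v = id \<or> (\<forall>p. v p \<noteq> p))"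
proof
  assume "v \<in> Klein"
  then obtain s r where v: "v = arrow_sym s r" by (auto simp: Klein_def)
  have oa: "other_arrow x \<noteq> x" "other_arrow (other_arrow x) = x" for x by (cases x; simp)+
  have ot: "other_tip x \<noteq> x" "other_tip (other_tip x) = x" for x by (cases x; simp)+
  show "(\<forall>p. v (v p) = p) \<and> (v = id \<or> (\<forall>p. v p \<noteq> p))"
    by (cases s; cases r) (auto simp: v oa ot)
next
  assume v: "(\<forall>p. v (v p) = p) \<and> (v = id \<or> (\<forall>p. v p \<noteq> p))"
  show "v \<in> Klein"
  proof (cases "v = id")
    case True
    moreover have "arrow_sym False False = id" by auto
    ultimately show ?thesis using arrow_sym_in_Klein by metis
  next
    case False
    define a b c d where "a = (ArrA, Tail)" and "b = (ArrA, Head)" and "c = (ArrB, Tail)" and "d = (ArrB, Head)"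
    have ne: "a \<noteq> b" "a \<noteq> c" "a \<noteq> d" "b \<noteq> c" "b \<noteq> d" "c \<noteq> d" by (auto simp: a_def b_def c_def d_def)
    have "\<forall>p. p = a \<or> p = b \<or> p = c \<or> p = d"
      unfolding all_ends by (simp add: a_def b_def c_def d_def)
    then have "(v a = b \<and> v b = a \<and> v c = d \<and> v d = c) \<or> (v a = c \<and> v c = a \<and> v b = d \<and> v d = b) \<or>
        (v a = d \<and> v d = a \<and> v b = c \<and> v c = b)"
    proof -
      have fixed_point_free: "v p \<noteq> p" and involution: "v (v p) = p" for p
        using v False by blast+
      have cover: "v p = a \<or> v p = b \<or> v p = c \<or> v p = d" for p
        using \<open>\<forall>p. p = a \<or> p = b \<or> p = c \<or> p = d\<close> by blast
      have "v a = b \<or> v a = c \<or> v a = d" "v b = a \<or> v b = c \<or> v b = d"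
        "v c = a \<or> v c = b \<or> v c = d" "v d = a \<or> v d = b \<or> v d = c"
        using cover fixed_point_free by metis+
      moreover have "v a = b \<longleftrightarrow> v b = a" "v a = c \<longleftrightarrow> v c = a" "v a = d \<longleftrightarrow> v d = a"
        "v b = c \<longleftrightarrow> v c = b" "v b = d \<longleftrightarrow> v d = b" "v c = d \<longleftrightarrow> v d = c"
        by (metis involution)+
      ultimately show ?thesis using ne by auto
    qed
    then have "v = arrow_sym False True \<or> v = arrow_sym True False \<or> v = arrow_sym True True"
      unfolding fun_eq_iff all_ends by (auto simp: a_def b_def c_def d_def)
    then show ?thesis using arrow_sym_in_Klein by metis
  qed
qed

lemma id_in_Klein: "id \<in> Klein"
  by (simp add: Klein_iff)

lemma Klein_involution: "v \<in> Klein \<Longrightarrow> v (v p) = p"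
  unfolding Klein_iff by blast

lemma Klein_comp:
  assumes "v \<in> Klein" "w \<in> Klein"
  shows "v \<circ> w \<in> Klein"
proof -
  have oa: "other_arrow (other_arrow x) = x" for x by (cases x; simp)
  have ot: "other_tip (other_tip x) = x" for x by (cases x; simp)
  obtain s r s' r' where "v = arrow_sym s r" "w = arrow_sym s' r'"
    using assms by (auto simp: Klein_def)
  then have "v \<circ> w = arrow_sym (s \<noteq> s') (r \<noteq> r')" by (auto simp: oa ot)
  then show ?thesis by (simp add: arrow_sym_in_Klein)
qed

text \<open>Normality is what lets renamings of arrow ends descend to isomorphism classes: the symmetric
  group on the four ends modulo this subgroup has order six and is the group of ribbon operations.\<close>

lemma Klein_normal:
  assumes "bij f" "v \<in> Klein"
  shows "f \<circ> v \<circ> inv' f \<in> Klein"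
proof -
  have [simp]: "inv' f (f p) = p" "f (inv' f p) = p" for p
    using assms(1) by (auto simp: bij_is_inj bij_is_surj surj_f_inv_f)
  have "f (v (inv' f p)) \<noteq> p" if "v \<noteq> id" for p
  proof
    assume "f (v (inv' f p)) = p"
    then have "v (inv' f p) = inv' f p" by (metis \<open>\<And>p. inv' f (f p) = p\<close>)
    with that assms(2) show False unfolding Klein_iff by blast
  qed
  moreover have "f \<circ> id \<circ> inv' f = id" by (simp add: fun_eq_iff)
  moreover have "f (v (inv' f (f (v (inv' f p))))) = p" for p
    by (simp add: Klein_involution[OF assms(2)])
  ultimately show ?thesis unfolding Klein_iff comp_apply by metis
qed

text \<open>Equality up to a symmetry of the edge disc applied last.  By normality a symmetry applied first
  would define the same relation.\<close>

definition Klein_eq :: "(arrow \<times> tip \<Rightarrow> arrow \<times> tip) \<Rightarrow> (arrow \<times> tip \<Rightarrow> arrow \<times> tip) \<Rightarrow> bool" where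
  "Klein_eq f g \<longleftrightarrow> (\<exists>v\<in>Klein. f = v \<circ> g)"

lemma Klein_eq_refl: "Klein_eq f f"
  unfolding Klein_eq_def using id_in_Klein by (metis id_comp)

lemma Klein_eq_sym: "Klein_eq f g \<Longrightarrow> Klein_eq g f"
proof -
  assume "Klein_eq f g"
  then obtain v where v: "v \<in> Klein" "f = v \<circ> g" by (auto simp: Klein_eq_def)
  then have "g = v \<circ> f" by (simp add: fun_eq_iff Klein_involution)
  with v(1) show "Klein_eq g f" by (auto simp: Klein_eq_def)
qed

lemma Klein_eq_trans: "Klein_eq f g \<Longrightarrow> Klein_eq g h \<Longrightarrow> Klein_eq f h"
  unfolding Klein_eq_def by (metis Klein_comp comp_assoc)

lemma Klein_eq_comp_right: "Klein_eq f g \<Longrightarrow> Klein_eq (f \<circ> h) (g \<circ> h)"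
  unfolding Klein_eq_def by (metis comp_assoc)

lemma Klein_eq_comp_left:
  assumes "bij h" "Klein_eq f g"
  shows "Klein_eq (h \<circ> f) (h \<circ> g)"
proof -
  obtain v where v: "v \<in> Klein" "f = v \<circ> g" using assms(2) by (auto simp: Klein_eq_def)
  have "h \<circ> f = (h \<circ> v \<circ> inv' h) \<circ> (h \<circ> g)"
    using assms(1) v(2) by (auto simp: fun_eq_iff bij_is_inj)
  then show ?thesis using Klein_normal[OF assms(1) v(1)] by (auto simp: Klein_eq_def)
qed

definition word_perm :: "generator list \<Rightarrow> arrow \<times> tip \<Rightarrow> arrow \<times> tip" where
  "word_perm w = foldr (\<lambda>x f. new_name x \<circ> f) w id"

lemma word_perm_simps [simp]:
  "word_perm [] = id" "word_perm (x # w) = new_name x \<circ> word_perm w"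
  by (auto simp: word_perm_def)

lemma word_perm_append: "word_perm (u @ v) = word_perm u \<circ> word_perm v"
  by (induction u) (auto simp: comp_assoc)

lemma word_perm_relator:
  assumes "r \<in> relators"
  shows "word_perm r \<in> Klein"
proof -
  have "word_perm [Delta, Delta] = arrow_sym True False"
    unfolding fun_eq_iff all_ends by simp
  moreover have "word_perm [Tau, Tau] = id"
    unfolding fun_eq_iff all_ends by simp
  moreover have "word_perm [Tau, Delta, Tau, Delta, Tau, Delta] = id"
    unfolding fun_eq_iff all_ends by simp
  ultimately show ?thesis
    using assms id_in_Klein arrow_sym_in_Klein unfolding relators_def by (metis empty_iff insert_iff)
qed

text \<open>Each generator squares into the Klein group, whose elements are involutions, so its fourth
  power is the identity.\<close>

lemma bij_word_perm: "bij (word_perm w)"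
proof (induction w)
  case (Cons x w)
  have "word_perm [x, x] \<in> Klein"
    by (rule word_perm_relator) (cases x; simp add: relators_def)
  then have "(new_name x \<circ> new_name x) ((new_name x \<circ> new_name x) p) = p" for p
    using Klein_involution[of "word_perm [x, x]"] by simp
  then have "bij (new_name x)"
    by (intro o_bij[of "new_name x \<circ> new_name x \<circ> new_name x"]) (auto simp: fun_eq_iff)
  from bij_comp[OF Cons this] show ?case by (simp only: word_perm_simps)
qed (simp only: word_perm_simps bij_id)

text \<open>Every relator renames the ends by a symmetry of the edge disc.  So the renaming by a word
  depends, up to such symmetries, only on the group element the word represents.\<close>

lemma word_perm_cong: "word_eq u v \<Longrightarrow> Klein_eq (word_perm u) (word_perm v)"
proof (induction rule: word_eq.induct)
  case (cancel r u v)
  have "Klein_eq (word_perm r) id"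
    using word_perm_relator[OF cancel] by (auto simp: Klein_eq_def)
  from Klein_eq_comp_left[OF bij_word_perm[of u] Klein_eq_comp_right[OF this, of "word_perm v"]]
  show ?case by (simp only: word_perm_append id_comp)
qed (auto intro: Klein_eq_refl Klein_eq_sym Klein_eq_trans)

text \<open>The word is the arbitrary representative used by \<^const>\<open>apply_op\<close>, so that products
  are respected only up to \<^const>\<open>Klein_eq\<close>.\<close>

definition op_perm :: "ribbon_op \<Rightarrow> arrow \<times> tip \<Rightarrow> arrow \<times> tip" where
  "op_perm \<xi> = word_perm (rep_ribbon_op \<xi>)"

lemma bij_op_perm: "bij (op_perm \<xi>)"
  by (simp add: op_perm_def bij_word_perm)

lemma word_eq_rep_abs: "word_eq (rep_ribbon_op (abs_ribbon_op w)) w"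
  using Quotient3_ribbon_op Quotient3_rep_abs word_eq.refl by fastforce

lemma op_perm_one: "Klein_eq (op_perm \<one>\<^bsub>\<SS>\<^esub>) id"
  using word_perm_cong[OF word_eq_rep_abs[of "[]"]]
  by (simp add: op_perm_def ribbon_group_ops_def ribbon_op_one_def)

lemma op_perm_mult: "Klein_eq (op_perm (\<xi> \<otimes>\<^bsub>\<SS>\<^esub> \<eta>)) (op_perm \<xi> \<circ> op_perm \<eta>)"
proof -
  have "\<xi> \<otimes>\<^bsub>\<SS>\<^esub> \<eta> = abs_ribbon_op (rep_ribbon_op \<xi> @ rep_ribbon_op \<eta>)"
    using ribbon_op_mult.abs_eq[of "rep_ribbon_op \<xi>" "rep_ribbon_op \<eta>"]
    by (simp add: ribbon_group_ops_def Quotient3_abs_rep[OF Quotient3_ribbon_op])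
  with word_perm_cong[OF word_eq_rep_abs[of "rep_ribbon_op \<xi> @ rep_ribbon_op \<eta>"]]
  show ?thesis by (simp add: op_perm_def word_perm_append)
qed

section \<open>Graphs with renamed arrow ends\<close>

text \<open>One permutation of the four ends for each edge.  Composing such families replaces all
  bookkeeping about the order in which operations are applied to different edges.\<close>

definition blockwise :: "('e \<Rightarrow> arrow \<times> tip \<Rightarrow> arrow \<times> tip) \<Rightarrow> 'e arrow_end \<Rightarrow> 'e arrow_end" where
  "blockwise \<Phi> = (\<lambda>(e, p). (e, \<Phi> e p))"

definition relabel :: "('e \<Rightarrow> arrow \<times> tip \<Rightarrow> arrow \<times> tip) \<Rightarrow> 'e ribbon_graph \<Rightarrow> 'e ribbon_graph" where
  "relabel \<Phi> G = G\<lparr>arc := blockwise \<Phi> \<circ> arc G \<circ> inv' (blockwise \<Phi>)\<rparr>"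

lemma relabel_simps [simp]:
  "edges (relabel \<Phi> G) = edges G" "isolated (relabel \<Phi> G) = isolated G"
  "arrow_ends (relabel \<Phi> G) = arrow_ends G"
  by (auto simp: relabel_def arrow_ends_def)

lemma blockwise_inverse:
  assumes "\<And>e. bij (\<Phi> e)"
  shows "bij (blockwise \<Phi>)" "inv' (blockwise \<Phi>) = blockwise (\<lambda>e. inv' (\<Phi> e))"
proof -
  have inverse: "inv' (\<Phi> e) (\<Phi> e p) = p" "\<Phi> e (inv' (\<Phi> e) p) = p" for e p
    using assms[of e] by (auto simp: bij_is_inj bij_is_surj surj_f_inv_f)
  have 1: "blockwise (\<lambda>e. inv' (\<Phi> e)) \<circ> blockwise \<Phi> = id"
    and 2: "blockwise \<Phi> \<circ> blockwise (\<lambda>e. inv' (\<Phi> e)) = id"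
    by (auto simp: blockwise_def fun_eq_iff inverse)
  show "bij (blockwise \<Phi>)" by (rule o_bij[OF 1 2])
  show "inv' (blockwise \<Phi>) = blockwise (\<lambda>e. inv' (\<Phi> e))" by (rule inv_unique_comp[OF 2 1])
qed

text \<open>Evaluating the new involution at a renamed end avoids any mention of inverses.\<close>

lemma arc_relabel:
  assumes "\<And>e. bij (\<Phi> e)"
  shows "arc (relabel \<Phi> G) (e, \<Phi> e p) = blockwise \<Phi> (arc G (e, p))"
  using assms by (simp add: relabel_def blockwise_inverse bij_is_inj) (simp add: blockwise_def bij_is_inj)

lemma relabel_relabel:
  assumes "\<And>e. bij (\<Phi> e)" "\<And>e. bij (\<Psi> e)"
  shows "relabel \<Phi> (relabel \<Psi> G) = relabel (\<lambda>e. \<Phi> e \<circ> \<Psi> e) G"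
proof -
  have "blockwise (\<lambda>e. \<Phi> e \<circ> \<Psi> e) = blockwise \<Phi> \<circ> blockwise \<Psi>"
    by (auto simp: blockwise_def)
  then show ?thesis
    using assms by (simp add: relabel_def o_inv_distrib blockwise_inverse(1) comp_assoc)
qed

lemma relabel_id:
  fixes G :: "'e ribbon_graph"
  shows "relabel (\<lambda>_. id) G = G"
proof -
  have "blockwise (\<lambda>_. id) = (id :: 'e arrow_end \<Rightarrow> _)" by (auto simp: blockwise_def)
  then show ?thesis by (simp add: relabel_def inv_id)
qed

lemma is_ribbon_graph_relabel:
  assumes "\<And>e. bij (\<Phi> e)" "is_ribbon_graph G"
  shows "is_ribbon_graph (relabel \<Phi> G)"
  unfolding is_ribbon_graph_def
proof (intro conjI ballI)
  show "finite (edges (relabel \<Phi> G))" using assms(2) by (simp add: is_ribbon_graph_def)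
  fix p assume "p \<in> arrow_ends (relabel \<Phi> G)"
  then obtain e p' where e: "p = (e, p')" "e \<in> edges G" by (auto simp: arrow_ends_def)
  obtain q where "p' = \<Phi> e q" using bij_is_surj[OF assms(1)] by (metis surjD)
  with e have p: "p = (e, \<Phi> e q)" and q: "(e, q) \<in> arrow_ends G"
    by (simp_all add: arrow_ends_def)
  obtain e' q' where eq: "arc G (e, q) = (e', q')" by (cases "arc G (e, q)")
  have *: "(e', q') \<in> arrow_ends G" "(e', q') \<noteq> (e, q)" "arc G (e', q') = (e, q)"
    using assms(2) q eq by (force simp: is_ribbon_graph_def)+
  have a: "arc (relabel \<Phi> G) p = (e', \<Phi> e' q')" "arc (relabel \<Phi> G) (e', \<Phi> e' q') = p"
    using arc_relabel[of \<Phi> G, OF assms(1)] eq * by (simp_all add: p blockwise_def)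
  show "arc (relabel \<Phi> G) p \<in> arrow_ends (relabel \<Phi> G)"
    "arc (relabel \<Phi> G) (arc (relabel \<Phi> G) p) = p"
    using a * by (auto simp: arrow_ends_def)
  show "arc (relabel \<Phi> G) p \<noteq> p"
    using a(1) *(2) assms(1) by (auto simp: p bij_def inj_eq)
qed

lemma apply_generator_relabel:
  "apply_generator e x G = relabel ((\<lambda>_. id)(e := new_name x)) G"
proof -
  have "rename_at e (new_name x) = blockwise ((\<lambda>_. id)(e := new_name x))"
    by (auto simp: rename_at_def blockwise_def fun_eq_iff)
  then show ?thesis by (simp add: apply_generator_def relabel_def Let_def)
qed

lemma apply_op_relabel: "apply_op e \<xi> G = relabel ((\<lambda>_. id)(e := op_perm \<xi>)) G"
proof -
  have "apply_word e w G = relabel ((\<lambda>_. id)(e := word_perm w)) G" for w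
  proof (induction w)
    case Nil
    then show ?case by (simp add: apply_word_def relabel_id[unfolded id_def])
  next
    case (Cons x w)
    have "bij (new_name x)" using bij_word_perm[of "[x]"] by simp
    then have "relabel ((\<lambda>_. id)(e := new_name x)) (relabel ((\<lambda>_. id)(e := word_perm w)) G)
        = relabel (\<lambda>e'. ((\<lambda>_. id)(e := new_name x)) e' \<circ> ((\<lambda>_. id)(e := word_perm w)) e') G"
      by (intro relabel_relabel) (simp_all add: bij_word_perm)
    also have "(\<lambda>e'. ((\<lambda>_. id)(e := new_name x)) e' \<circ> ((\<lambda>_. id)(e := word_perm w)) e')
        = (\<lambda>_. id)(e := word_perm (x # w))" by auto
    finally show ?case
      using Cons by (simp only: apply_word_def foldr.simps comp_apply apply_generator_relabel)
  qed
  then show ?thesis by (simp add: apply_op_def op_perm_def)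
qed

text \<open>Indexed by edges rather than positions, to fit \<^const>\<open>relabel\<close>.\<close>

definition edge_perms :: "nat \<Rightarrow> (nat \<Rightarrow> ribbon_op) \<Rightarrow> (nat \<Rightarrow> 'e) \<Rightarrow> 'e \<Rightarrow> arrow \<times> tip \<Rightarrow> arrow \<times> tip" where
  "edge_perms n \<gamma> l e = (if e \<in> l ` {1..n} then op_perm (\<gamma> (inv_into {1..n} l e)) else id)"

lemma bij_edge_perms: "bij (edge_perms n \<gamma> l e)"
  by (simp add: edge_perms_def bij_op_perm)

lemma edge_perms_eq:
  "inj_on l {1..n} \<Longrightarrow> i \<in> {1..n} \<Longrightarrow> edge_perms n \<gamma> l (l i) = op_perm (\<gamma> i)"
  by (simp add: edge_perms_def)

lemma apply_all_relabel:
  assumes "inj_on l {1..n}"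
  shows "apply_all n \<gamma> l G = relabel (edge_perms n \<gamma> l) G"
proof -
  have "fold (\<lambda>i. apply_op (l i) (\<gamma> i)) is G
      = relabel (\<lambda>e. if e \<in> l ` set is then edge_perms n \<gamma> l e else id) G"
    if "distinct is" "set is \<subseteq> {1..n}" for "is"
    using that
  proof (induction "is" rule: rev_induct)
    case Nil
    then show ?case by (simp add: relabel_id[unfolded id_def])
  next
    case (snoc i "is")
    have IH: "fold (\<lambda>i. apply_op (l i) (\<gamma> i)) is G
        = relabel (\<lambda>e. if e \<in> l ` set is then edge_perms n \<gamma> l e else id) G"
      by (rule snoc.IH) (use snoc.prems in auto)
    have new: "l i \<notin> l ` set is" using snoc.prems assms by (auto dest: inj_onD)
    have "fold (\<lambda>i. apply_op (l i) (\<gamma> i)) (is @ [i]) G = relabel (\<lambda>e. ((\<lambda>_. id)(l i := op_perm (\<gamma> i))) e \<circ>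
        (if e \<in> l ` set is then edge_perms n \<gamma> l e else id)) G"
    proof -
      have "fold (\<lambda>i. apply_op (l i) (\<gamma> i)) (is @ [i]) G = relabel ((\<lambda>_. id)(l i := op_perm (\<gamma> i)))
          (relabel (\<lambda>e. if e \<in> l ` set is then edge_perms n \<gamma> l e else id) G)"
        by (simp only: fold_append comp_apply fold.simps id_apply IH) (simp only: apply_op_relabel)
      also have "\<dots> = relabel (\<lambda>e. ((\<lambda>_. id)(l i := op_perm (\<gamma> i))) e \<circ>
          (if e \<in> l ` set is then edge_perms n \<gamma> l e else id)) G"
        by (intro relabel_relabel) (simp_all add: bij_op_perm bij_edge_perms)
      finally show ?thesis .
    qed
    also have "(\<lambda>e. ((\<lambda>_. id)(l i := op_perm (\<gamma> i))) e \<circ>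
        (if e \<in> l ` set is then edge_perms n \<gamma> l e else id))
        = (\<lambda>e. if e \<in> l ` set (is @ [i]) then edge_perms n \<gamma> l e else id)"
      using new snoc.prems edge_perms_eq[OF assms, of i \<gamma>] by (auto simp: fun_eq_iff)
    finally show ?case .
  qed
  from this[of "[1..<Suc n]"]
  have "apply_all n \<gamma> l G = relabel (\<lambda>e. if e \<in> l ` {1..n} then edge_perms n \<gamma> l e else id) G"
    by (simp only: apply_all_def set_upt distinct_upt atLeastLessThanSuc_atLeastAtMost)
  also have "(\<lambda>e. if e \<in> l ` {1..n} then edge_perms n \<gamma> l e else id) = edge_perms n \<gamma> l"
    by (auto simp: edge_perms_def fun_eq_iff)
  finally show ?thesis .
qed

section \<open>Isomorphism of ordered graphs\<close>

definition map_ends :: "('e \<Rightarrow> 'e) \<Rightarrow> ('e \<Rightarrow> arrow \<times> tip \<Rightarrow> arrow \<times> tip) \<Rightarrow> 'e arrow_end \<Rightarrow> 'e arrow_end" where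
  "map_ends h \<sigma> = (\<lambda>(e, p). (h e, \<sigma> e p))"

lemma map_ends_pair [simp]: "map_ends h \<sigma> (e, p) = (h e, \<sigma> e p)"
  by (simp add: map_ends_def)

text \<open>An isomorphism of ribbon graphs together with the symmetry it induces on each edge disc.
  Keeping the symmetry as one permutation in the Klein group, instead of two Booleans, makes
  composition and conjugation direct.\<close>

definition ends_iso :: "('e \<Rightarrow> 'e) \<Rightarrow> ('e \<Rightarrow> arrow \<times> tip \<Rightarrow> arrow \<times> tip) \<Rightarrow> 'e ribbon_graph \<Rightarrow> 'e ribbon_graph \<Rightarrow> bool" where
  "ends_iso h \<sigma> G H \<longleftrightarrow> bij_betw h (edges G) (edges H) \<and> isolated G = isolated H \<and>
     (\<forall>e\<in>edges G. \<sigma> e \<in> Klein) \<and>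
     (\<forall>e\<in>edges G. \<forall>p. arc H (h e, \<sigma> e p) = map_ends h \<sigma> (arc G (e, p)))"

lemma ends_isoD:
  assumes "ends_iso h \<sigma> G H"
  shows "bij_betw h (edges G) (edges H)" "isolated G = isolated H"
    and "e \<in> edges G \<Longrightarrow> h e \<in> edges H" "e \<in> edges G \<Longrightarrow> \<sigma> e \<in> Klein"
    and "e \<in> edges G \<Longrightarrow> arc H (h e, \<sigma> e p) = map_ends h \<sigma> (arc G (e, p))"
  using assms unfolding ends_iso_def bij_betw_def by blast+

lemma arc_edge:
  assumes "is_ribbon_graph G" "e \<in> edges G"
  obtains e' p' where "arc G (e, p) = (e', p')" "e' \<in> edges G"
proof -
  have "(e, p) \<in> arrow_ends G" using assms(2) by (simp add: arrow_ends_def)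
  then have "arc G (e, p) \<in> arrow_ends G" using assms(1) unfolding is_ribbon_graph_def by blast
  then show ?thesis using that by (cases "arc G (e, p)") (auto simp: arrow_ends_def)
qed

lemma ribbon_iso_iff:
  assumes "is_ribbon_graph G"
  shows "ribbon_iso h G H \<longleftrightarrow> (\<exists>\<sigma>. ends_iso h \<sigma> G H)"
proof
  assume "ribbon_iso h G H"
  then obtain s r where sr: "bij_betw h (edges G) (edges H)" "isolated G = isolated H"
    "\<forall>p\<in>arrow_ends G. arc H (map_ends h (\<lambda>e. arrow_sym (s e) (r e)) p)
      = map_ends h (\<lambda>e. arrow_sym (s e) (r e)) (arc G p)"
    unfolding ribbon_iso_def map_ends_def Let_def by blast
  then have "ends_iso h (\<lambda>e. arrow_sym (s e) (r e)) G H"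
    unfolding ends_iso_def by (fastforce simp: arrow_ends_def arrow_sym_in_Klein)
  then show "\<exists>\<sigma>. ends_iso h \<sigma> G H" by blast
next
  assume "\<exists>\<sigma>. ends_iso h \<sigma> G H"
  then obtain \<sigma> where \<sigma>: "ends_iso h \<sigma> G H" by blast
  have "\<forall>e. \<exists>sr. e \<in> edges G \<longrightarrow> \<sigma> e = arrow_sym (fst sr) (snd sr)"
    using \<sigma> by (fastforce simp: ends_iso_def Klein_def)
  then obtain sr where sr: "\<And>e. e \<in> edges G \<Longrightarrow> \<sigma> e = arrow_sym (fst (sr e)) (snd (sr e))"
    by metis
  let ?\<sigma> = "\<lambda>e. arrow_sym (fst (sr e)) (snd (sr e))"
  have "arc H (map_ends h ?\<sigma> p) = map_ends h ?\<sigma> (arc G p)" if p: "p \<in> arrow_ends G" for p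
  proof -
    obtain e q where e: "p = (e, q)" "e \<in> edges G" using p by (auto simp: arrow_ends_def)
    obtain e' q' where e': "arc G (e, q) = (e', q')" "e' \<in> edges G" using arc_edge[OF assms e(2)] .
    have "arc H (h e, \<sigma> e q) = map_ends h \<sigma> (arc G (e, q))" by (rule ends_isoD(5)[OF \<sigma> e(2)])
    then show ?thesis using sr[OF e(2)] sr[OF e'(2)] e(1) e'(1) by simp
  qed
  then show "ribbon_iso h G H"
    using \<sigma> unfolding ribbon_iso_def ends_iso_def map_ends_def Let_def
    by (intro conjI exI[of _ "\<lambda>e. fst (sr e)"] exI[of _ "\<lambda>e. snd (sr e)"]) blast+
qed

lemma ends_iso_refl: "ends_iso id (\<lambda>_. id) G G"
  by (auto simp: ends_iso_def id_in_Klein map_ends_def split: prod.split)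

lemma ends_iso_sym:
  assumes G: "is_ribbon_graph G" and iso: "ends_iso h \<sigma> G H"
  shows "ends_iso (inv_into (edges G) h) (\<lambda>e. \<sigma> (inv_into (edges G) h e)) H G"
proof -
  let ?k = "inv_into (edges G) h"
  note bij = ends_isoD(1)[OF iso]
  then have k: "?k (h e) = e" if "e \<in> edges G" for e
    using that by (simp add: bij_betw_inv_into_left)
  have "arc G (?k e', \<sigma> (?k e') p) = map_ends ?k (\<lambda>e. \<sigma> (?k e)) (arc H (e', p))"
    if e': "e' \<in> edges H" for e' p
  proof -
    obtain e where e: "e' = h e" "e \<in> edges G"
      using e' bij_betw_imp_surj_on[OF bij] by blast
    obtain f q where f: "arc G (e, \<sigma> e p) = (f, q)" "f \<in> edges G" using arc_edge[OF G e(2)] .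
    have \<sigma>: "\<sigma> e (\<sigma> e p) = p" "\<sigma> f (\<sigma> f q) = q"
      by (simp_all only: Klein_involution ends_isoD(4)[OF iso] e(2) f(2))
    have "arc H (h e, \<sigma> e (\<sigma> e p)) = map_ends h \<sigma> (arc G (e, \<sigma> e p))"
      by (rule ends_isoD(5)[OF iso e(2)])
    then show ?thesis using \<sigma> by (simp add: e k f)
  qed
  moreover have "\<forall>e\<in>edges H. \<sigma> (?k e) \<in> Klein"
    using ends_isoD(4)[OF iso] bij_betw_apply[OF bij_betw_inv_into[OF bij]] by blast
  ultimately show ?thesis
    using ends_isoD(2)[OF iso] bij_betw_inv_into[OF bij] unfolding ends_iso_def by simp
qed

lemma ends_iso_trans:
  assumes G: "is_ribbon_graph G" and 1: "ends_iso h \<sigma> G H" and 2: "ends_iso k \<rho> H K"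
  shows "ends_iso (k \<circ> h) (\<lambda>e. \<rho> (h e) \<circ> \<sigma> e) G K"
proof -
  have "arc K ((k \<circ> h) e, (\<rho> (h e) \<circ> \<sigma> e) p) = map_ends (k \<circ> h) (\<lambda>e. \<rho> (h e) \<circ> \<sigma> e) (arc G (e, p))"
    if e: "e \<in> edges G" for e p
  proof -
    have "arc K (k (h e), \<rho> (h e) (\<sigma> e p)) = map_ends k \<rho> (map_ends h \<sigma> (arc G (e, p)))"
      by (simp only: ends_isoD(5)[OF 1 e] ends_isoD(5)[OF 2 ends_isoD(3)[OF 1 e]])
    then show ?thesis by (cases "arc G (e, p)") simp
  qed
  moreover have "\<forall>e\<in>edges G. \<rho> (h e) \<circ> \<sigma> e \<in> Klein"
    using ends_isoD(3,4)[OF 1] ends_isoD(4)[OF 2] by (blast intro: Klein_comp)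
  moreover have "bij_betw (k \<circ> h) (edges G) (edges K)"
    using ends_isoD(1)[OF 1] ends_isoD(1)[OF 2] by (rule bij_betw_trans)
  ultimately show ?thesis
    using ends_isoD(2)[OF 1] ends_isoD(2)[OF 2] unfolding ends_iso_def by simp
qed

text \<open>Renaming both graphs replaces the symmetry \<open>\<sigma> e\<close> by
  \<open>\<Psi> (h e) \<circ> \<sigma> e \<circ> (\<Phi> e)\<^sup>-\<^sup>1\<close>.  As \<open>\<Psi> (h e) = v \<circ> \<Phi> e\<close> with \<open>v\<close> in the Klein group, this is
  \<open>v\<close> times a conjugate of \<open>\<sigma> e\<close>, hence in the Klein group by normality.\<close>

lemma ends_iso_relabel:
  assumes G: "is_ribbon_graph G" and iso: "ends_iso h \<sigma> G H"
    and bij: "\<And>e. bij (\<Phi> e)" "\<And>e. bij (\<Psi> e)"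
    and eq: "\<And>e. e \<in> edges G \<Longrightarrow> Klein_eq (\<Psi> (h e)) (\<Phi> e)"
  shows "ends_iso h (\<lambda>e. \<Psi> (h e) \<circ> \<sigma> e \<circ> inv' (\<Phi> e)) (relabel \<Phi> G) (relabel \<Psi> H)"
proof -
  have "\<Psi> (h e) \<circ> \<sigma> e \<circ> inv' (\<Phi> e) \<in> Klein" if e: "e \<in> edges G" for e
  proof -
    obtain v where v: "v \<in> Klein" "\<Psi> (h e) = v \<circ> \<Phi> e"
      using eq[OF e] by (auto simp: Klein_eq_def)
    have "v \<circ> (\<Phi> e \<circ> \<sigma> e \<circ> inv' (\<Phi> e)) \<in> Klein"
      by (intro Klein_comp Klein_normal v(1) bij(1) ends_isoD(4)[OF iso e])
    then show ?thesis by (simp only: v(2) comp_assoc)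
  qed
  moreover have "arc (relabel \<Psi> H) (h e, (\<Psi> (h e) \<circ> \<sigma> e \<circ> inv' (\<Phi> e)) p)
      = map_ends h (\<lambda>e. \<Psi> (h e) \<circ> \<sigma> e \<circ> inv' (\<Phi> e)) (arc (relabel \<Phi> G) (e, p))"
    if e: "e \<in> edges G" for e p
  proof -
    obtain q where q: "p = \<Phi> e q" using bij_is_surj[OF bij(1)] by (metis surjD)
    have inv: "inv' (\<Phi> f) (\<Phi> f x) = x" for f x by (simp add: bij(1) bij_is_inj)
    obtain f r where f: "arc G (e, q) = (f, r)" "f \<in> edges G" using arc_edge[OF G e] .
    have "arc (relabel \<Psi> H) (h e, \<Psi> (h e) (\<sigma> e q)) = blockwise \<Psi> (arc H (h e, \<sigma> e q))"
      by (rule arc_relabel) (rule bij(2))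
    also have "arc H (h e, \<sigma> e q) = map_ends h \<sigma> (arc G (e, q))" by (rule ends_isoD(5)[OF iso e])
    also have "\<dots> = (h f, \<sigma> f r)" by (simp add: f)
    finally have "arc (relabel \<Psi> H) (h e, \<Psi> (h e) (\<sigma> e q)) = (h f, \<Psi> (h f) (\<sigma> f r))"
      by (simp add: blockwise_def)
    moreover have "arc (relabel \<Phi> G) (e, \<Phi> e q) = (f, \<Phi> f r)"
      using arc_relabel[of \<Phi> G e q, OF bij(1)] by (simp add: f blockwise_def)
    ultimately show ?thesis by (simp add: q inv)
  qed
  ultimately show ?thesis using ends_isoD(1,2)[OF iso] unfolding ends_iso_def by simp
qed

lemma ordered_iso_iff:
  "((G, l), (H, k)) \<in> ordered_iso n \<longleftrightarrow> (G, l) \<in> ordered_graphs n \<and> (H, k) \<in> ordered_graphs n \<and>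
     (\<exists>h \<sigma>. ends_iso h \<sigma> G H \<and> (\<forall>i\<in>{1..n}. h (l i) = k i))"
proof -
  have "(\<exists>h. ribbon_iso h G H \<and> (\<forall>i\<in>{1..n}. h (l i) = k i))
      \<longleftrightarrow> (\<exists>h \<sigma>. ends_iso h \<sigma> G H \<and> (\<forall>i\<in>{1..n}. h (l i) = k i))"
    if "(G, l) \<in> ordered_graphs n"
  proof -
    have "is_ribbon_graph G" using that by (simp add: ordered_graphs_def)
    then show ?thesis by (simp only: ribbon_iso_iff) blast
  qed
  then show ?thesis unfolding ordered_iso_def mem_Collect_eq prod.case by argo
qed

lemma ordered_iso_equiv: "equiv (ordered_graphs n :: 'e ordered_graph set) (ordered_iso n)"
proof (rule equivI)
  show "ordered_iso n \<subseteq> ordered_graphs n \<times> ordered_graphs n"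
    by (auto simp: ordered_iso_def)
  show "refl_on (ordered_graphs n) (ordered_iso n)"
    by (auto simp: refl_on_def ordered_iso_iff intro!: exI ends_iso_refl)
  show "sym (ordered_iso n :: ('e ordered_graph \<times> 'e ordered_graph) set)"
  proof (rule symI, clarify)
    fix G H :: "'e ribbon_graph" and l k
    assume "((G, l), (H, k)) \<in> ordered_iso n"
    then obtain h \<sigma> where *: "(G, l) \<in> ordered_graphs n" "(H, k) \<in> ordered_graphs n"
      "ends_iso h \<sigma> G H" "\<forall>i\<in>{1..n}. h (l i) = k i" by (auto simp: ordered_iso_iff)
    have G: "is_ribbon_graph G" "bij_betw l {1..n} (edges G)"
      using *(1) by (auto simp: ordered_graphs_def)
    have "inv_into (edges G) h (k i) = l i" if "i \<in> {1..n}" for i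
    proof -
      have "l i \<in> edges G" using G(2) that by (auto simp: bij_betw_def)
      moreover have "bij_betw h (edges G) (edges H)" by (rule ends_isoD(1)[OF *(3)])
      ultimately show ?thesis using *(4) that by (metis bij_betw_inv_into_left)
    qed
    then show "((H, k), (G, l)) \<in> ordered_iso n"
      unfolding ordered_iso_iff using * ends_iso_sym[OF G(1) *(3)] by blast
  qed
  show "trans (ordered_iso n :: ('e ordered_graph \<times> 'e ordered_graph) set)"
  proof (rule transI, clarify)
    fix G H K :: "'e ribbon_graph" and l k m
    assume "((G, l), (H, k)) \<in> ordered_iso n" "((H, k), (K, m)) \<in> ordered_iso n"
    then obtain h \<sigma> h' \<sigma>' where *: "(G, l) \<in> ordered_graphs n" "(K, m) \<in> ordered_graphs n"
      "ends_iso h \<sigma> G H" "\<forall>i\<in>{1..n}. h (l i) = k i"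
      "ends_iso h' \<sigma>' H K" "\<forall>i\<in>{1..n}. h' (k i) = m i" by (auto simp: ordered_iso_iff)
    then have "is_ribbon_graph G" by (auto simp: ordered_graphs_def)
    from ends_iso_trans[OF this *(3,5)] have "\<exists>h \<sigma>. ends_iso h \<sigma> G K \<and> (\<forall>i\<in>{1..n}. h (l i) = m i)"
      using *(4,6) by (intro exI conjI) auto
    then show "((G, l), (K, m)) \<in> ordered_iso n"
      unfolding ordered_iso_iff using *(1,2) by blast
  qed
qed

lemma ordered_graphs_relabel:
  assumes "(G, l) \<in> ordered_graphs n" "p permutes {1..n}" "\<And>e. bij (\<Phi> e)"
  shows "(relabel \<Phi> G, l \<circ> p) \<in> ordered_graphs n"
proof -
  have G: "is_ribbon_graph G" "card (edges G) = n" "bij_betw l {1..n} (edges G)"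
    using assms(1) by (auto simp: ordered_graphs_def)
  show ?thesis
    using G is_ribbon_graph_relabel[of \<Phi> G, OF assms(3) G(1)]
      bij_betw_trans[OF permutes_imp_bij[OF assms(2)] G(3)]
    by (simp add: ordered_graphs_def)
qed

text \<open>That the action is well defined on classes, and that it satisfies the two laws of an action,
  are all instances of this lemma.  The permutation \<open>p\<close> is there because the action also moves
  the ordering.\<close>

lemma ordered_iso_relabel:
  assumes iso: "((G, l), (H, k)) \<in> ordered_iso n" and p: "p permutes {1..n}"
    and bij: "\<And>e. bij (\<Phi> e)" "\<And>e. bij (\<Psi> e)"
    and eq: "\<And>i. i \<in> {1..n} \<Longrightarrow> Klein_eq (\<Psi> (k i)) (\<Phi> (l i))"
  shows "((relabel \<Phi> G, l \<circ> p), (relabel \<Psi> H, k \<circ> p)) \<in> ordered_iso n"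
proof -
  obtain h \<sigma> where *: "(G, l) \<in> ordered_graphs n" "(H, k) \<in> ordered_graphs n"
    "ends_iso h \<sigma> G H" "\<forall>i\<in>{1..n}. h (l i) = k i" using iso by (auto simp: ordered_iso_iff)
  then have G: "is_ribbon_graph G" "edges G = l ` {1..n}"
    by (auto simp: ordered_graphs_def bij_betw_def)
  have "Klein_eq (\<Psi> (h e)) (\<Phi> e)" if "e \<in> edges G" for e
    using that eq *(4) by (auto simp: G(2))
  then have "ends_iso h (\<lambda>e. \<Psi> (h e) \<circ> \<sigma> e \<circ> inv' (\<Phi> e)) (relabel \<Phi> G) (relabel \<Psi> H)"
    using G(1) *(3) bij by (intro ends_iso_relabel)
  moreover have "\<forall>i\<in>{1..n}. h ((l \<circ> p) i) = (k \<circ> p) i"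
    using *(4) permutes_in_image[OF p] by simp
  moreover have "(relabel \<Phi> G, l \<circ> p) \<in> ordered_graphs n" "(relabel \<Psi> H, k \<circ> p) \<in> ordered_graphs n"
    by (rule ordered_graphs_relabel[OF *(1) p bij(1)], rule ordered_graphs_relabel[OF *(2) p bij(2)])
  ultimately show ?thesis unfolding ordered_iso_iff by blast
qed

section \<open>The action on ordered graphs\<close>

lemma semidirect_carrier:
  "(\<gamma>, \<pi>) \<in> carrier (semidirect n) \<longleftrightarrow> \<gamma> \<in> carrier (ops_power n) \<and> \<pi> permutes {1..n}"
  by (simp add: semidirect_def sym_group_def)

lemma ops_power_carrier: "\<gamma> \<in> carrier (ops_power n) \<longleftrightarrow> \<gamma> \<in> extensional {1..n}"
  by (auto simp: ribbon_group_ops_def PiE_def)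

lemma semidirect_mult:
  "(\<gamma>\<^sub>1, \<pi>\<^sub>1) \<otimes>\<^bsub>semidirect n\<^esub> (\<gamma>\<^sub>2, \<pi>\<^sub>2) = ((\<lambda>i\<in>{1..n}. \<gamma>\<^sub>1 i \<otimes>\<^bsub>\<SS>\<^esub> \<gamma>\<^sub>2 (inv' \<pi>\<^sub>1 i)), \<pi>\<^sub>1 \<circ> \<pi>\<^sub>2)"
  by (simp add: semidirect_def)

lemma semidirect_one: "\<one>\<^bsub>semidirect n\<^esub> = ((\<lambda>i\<in>{1..n}. \<one>\<^bsub>\<SS>\<^esub>), id)"
  by (simp add: semidirect_def)

interpretation S: group \<SS>
  by (rule group_ribbon_ops)

lemma in_carrier [simp]: "x \<in> carrier \<SS>"
  by (simp add: ribbon_group_ops_def)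

lemma group_semidirect: "group (semidirect n)"
proof (rule groupI)
  fix x y z assume xyz: "x \<in> carrier (semidirect n)" "y \<in> carrier (semidirect n)" "z \<in> carrier (semidirect n)"
  obtain \<gamma>1 \<pi>1 \<gamma>2 \<pi>2 \<gamma>3 \<pi>3 where e: "x = (\<gamma>1, \<pi>1)" "y = (\<gamma>2, \<pi>2)" "z = (\<gamma>3, \<pi>3)"
    by (metis surj_pair)
  have \<pi>: "\<pi>1 permutes {1..n}" "\<pi>2 permutes {1..n}" "\<pi>3 permutes {1..n}"
    and \<gamma>: "\<gamma>1 \<in> extensional {1..n}"
    using xyz unfolding e semidirect_carrier ops_power_carrier by auto
  have inv: "inv' (\<pi>1 \<circ> \<pi>2) = inv' \<pi>2 \<circ> inv' \<pi>1"
    using \<pi> by (simp add: o_inv_distrib permutes_bij)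
  have mem: "inv' \<pi>1 i \<in> {1..n} \<longleftrightarrow> i \<in> {1..n}" for i
    using permutes_in_image[OF permutes_inv[OF \<pi>(1)]] .
  show "x \<otimes>\<^bsub>semidirect n\<^esub> y \<in> carrier (semidirect n)"
    unfolding e semidirect_mult semidirect_carrier ops_power_carrier
    using \<pi> by (simp add: permutes_compose)
  show "x \<otimes>\<^bsub>semidirect n\<^esub> y \<otimes>\<^bsub>semidirect n\<^esub> z = x \<otimes>\<^bsub>semidirect n\<^esub> (y \<otimes>\<^bsub>semidirect n\<^esub> z)"
    unfolding e semidirect_mult inv using mem
    by (auto simp: fun_eq_iff restrict_def S.m_assoc)
  show "\<one>\<^bsub>semidirect n\<^esub> \<otimes>\<^bsub>semidirect n\<^esub> x = x"
    unfolding e semidirect_one semidirect_mult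
    using \<gamma> by (auto simp: fun_eq_iff restrict_def extensional_def)
  show "\<exists>y\<in>carrier (semidirect n). y \<otimes>\<^bsub>semidirect n\<^esub> x = \<one>\<^bsub>semidirect n\<^esub>"
  proof
    show "((\<lambda>i\<in>{1..n}. inv\<^bsub>\<SS>\<^esub> \<gamma>1 (\<pi>1 i)), inv' \<pi>1) \<in> carrier (semidirect n)"
      unfolding semidirect_carrier ops_power_carrier using \<pi> by (simp add: permutes_inv)
    show "((\<lambda>i\<in>{1..n}. inv\<^bsub>\<SS>\<^esub> \<gamma>1 (\<pi>1 i)), inv' \<pi>1) \<otimes>\<^bsub>semidirect n\<^esub> x = \<one>\<^bsub>semidirect n\<^esub>"
      unfolding e semidirect_mult semidirect_one
      using \<pi>(1) by (auto simp: fun_eq_iff permutes_inv_inv permutes_inv_o)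
  qed
next
  show "\<one>\<^bsub>semidirect n\<^esub> \<in> carrier (semidirect n)"
    unfolding semidirect_one semidirect_carrier ops_power_carrier by (simp add: permutes_id)
qed

lemma act_graph_relabel:
  assumes "(G, l) \<in> ordered_graphs n" "\<pi> permutes {1..n}"
  shows "act_graph n (\<gamma>, \<pi>) (G, l) = (relabel (edge_perms n \<gamma> (l \<circ> inv' \<pi>)) G, l \<circ> inv' \<pi>)"
    and "inj_on (l \<circ> inv' \<pi>) {1..n}"
proof -
  have "bij_betw l {1..n} (edges G)" using assms(1) by (simp add: ordered_graphs_def)
  from bij_betw_trans[OF permutes_imp_bij[OF permutes_inv[OF assms(2)]] this]
  show inj: "inj_on (l \<circ> inv' \<pi>) {1..n}" by (simp add: bij_betw_def)
  show "act_graph n (\<gamma>, \<pi>) (G, l) = (relabel (edge_perms n \<gamma> (l \<circ> inv' \<pi>)) G, l \<circ> inv' \<pi>)"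
    by (simp only: act_graph.simps apply_all_relabel[OF inj])
qed

lemma act_graph_closed:
  assumes "x \<in> ordered_graphs n" "a \<in> carrier (semidirect n)"
  shows "act_graph n a x \<in> ordered_graphs n"
proof -
  obtain G l \<gamma> \<pi> where e: "x = (G, l)" "a = (\<gamma>, \<pi>)" by (metis surj_pair)
  have "\<pi> permutes {1..n}" using assms(2) unfolding e semidirect_carrier by blast
  with assms(1) show ?thesis unfolding e
    by (simp only: act_graph_relabel) (intro ordered_graphs_relabel permutes_inv bij_edge_perms)
qed

lemma act_graph_cong:
  assumes "(x, y) \<in> ordered_iso n" "a \<in> carrier (semidirect n)"
  shows "(act_graph n a x, act_graph n a y) \<in> ordered_iso n"
proof -
  obtain G l H k \<gamma> \<pi> where e: "x = (G, l)" "y = (H, k)" "a = (\<gamma>, \<pi>)" by (metis surj_pair)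
  have \<pi>: "\<pi> permutes {1..n}" using assms(2) unfolding e semidirect_carrier by blast
  have x: "(G, l) \<in> ordered_graphs n" and y: "(H, k) \<in> ordered_graphs n"
    using assms(1) unfolding e by (auto simp: ordered_iso_iff)
  have "Klein_eq (edge_perms n \<gamma> (k \<circ> inv' \<pi>) (k i)) (edge_perms n \<gamma> (l \<circ> inv' \<pi>) (l i))"
    if i: "i \<in> {1..n}" for i
  proof -
    have "\<pi> i \<in> {1..n}" "inv' \<pi> (\<pi> i) = i"
      using permutes_in_image[OF \<pi>] i permutes_inverses(2)[OF \<pi>] by auto
    then show ?thesis
      using edge_perms_eq[OF act_graph_relabel(2)[OF x \<pi>], of "\<pi> i" \<gamma>]
        edge_perms_eq[OF act_graph_relabel(2)[OF y \<pi>], of "\<pi> i" \<gamma>] by (simp add: Klein_eq_refl)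
  qed
  with assms(1) show ?thesis
    unfolding e act_graph_relabel(1)[OF x \<pi>] act_graph_relabel(1)[OF y \<pi>]
    by (intro ordered_iso_relabel permutes_inv \<pi> bij_edge_perms)
qed

lemma act_graph_one:
  assumes "x \<in> ordered_graphs n"
  shows "(act_graph n \<one>\<^bsub>semidirect n\<^esub> x, x) \<in> ordered_iso n"
proof -
  obtain G l where e: "x = (G, l)" by fastforce
  have x: "(G, l) \<in> ordered_graphs n" using assms e by simp
  then have iso: "((G, l), (G, l)) \<in> ordered_iso n"
    using ordered_iso_equiv by (meson equiv_class_self equiv_def refl_onD)
  have inj: "inj_on l {1..n}" using act_graph_relabel(2)[OF x permutes_id] by simp
  have "Klein_eq ((\<lambda>_. id) (l i)) (edge_perms n (\<lambda>i\<in>{1..n}. \<one>\<^bsub>\<SS>\<^esub>) l (l i))" if "i \<in> {1..n}" for i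
    using edge_perms_eq[OF inj that] that Klein_eq_sym[OF op_perm_one] by simp
  then have "((relabel (edge_perms n (\<lambda>i\<in>{1..n}. \<one>\<^bsub>\<SS>\<^esub>) l) G, l \<circ> id), (relabel (\<lambda>_. id) G, l \<circ> id)) \<in> ordered_iso n"
    using bij_id by (intro ordered_iso_relabel iso permutes_id bij_edge_perms)
  then show ?thesis
    unfolding e semidirect_one act_graph_relabel(1)[OF x permutes_id] by (simp only: relabel_id inv_id comp_id)
qed

text \<open>The edge that ends up at position \<open>j\<close> was at position \<open>\<pi>\<^sub>1\<^sup>-\<^sup>1 j\<close> when \<open>\<gamma>\<^sub>2\<close> acted.  So it
  undergoes \<open>\<gamma>\<^sub>1 j\<close> after \<open>\<gamma>\<^sub>2 (\<pi>\<^sub>1\<^sup>-\<^sup>1 j)\<close>, which is the twisted product in the semidirect product.\<close>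

lemma act_graph_mult:
  assumes "x \<in> ordered_graphs n" "a \<in> carrier (semidirect n)" "b \<in> carrier (semidirect n)"
  shows "(act_graph n (a \<otimes>\<^bsub>semidirect n\<^esub> b) x, act_graph n a (act_graph n b x)) \<in> ordered_iso n"
proof -
  obtain G l \<gamma>1 \<pi>1 \<gamma>2 \<pi>2 where e: "x = (G, l)" "a = (\<gamma>1, \<pi>1)" "b = (\<gamma>2, \<pi>2)" by (metis surj_pair)
  have \<pi>: "\<pi>1 permutes {1..n}" "\<pi>2 permutes {1..n}"
    using assms(2,3) unfolding e semidirect_carrier by auto
  have \<pi>12: "(\<pi>1 \<circ> \<pi>2) permutes {1..n}" using \<pi> by (simp add: permutes_compose)
  have inv: "l \<circ> inv' (\<pi>1 \<circ> \<pi>2) = l \<circ> inv' \<pi>2 \<circ> inv' \<pi>1"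
    using \<pi> by (simp add: o_inv_distrib permutes_bij comp_assoc)
  let ?\<gamma> = "\<lambda>i\<in>{1..n}. \<gamma>1 i \<otimes>\<^bsub>\<SS>\<^esub> \<gamma>2 (inv' \<pi>1 i)"
  let ?l = "l \<circ> inv' \<pi>2 \<circ> inv' \<pi>1"
  let ?\<Phi> = "\<lambda>e. edge_perms n \<gamma>1 ?l e \<circ> edge_perms n \<gamma>2 (l \<circ> inv' \<pi>2) e"
  have x: "(G, l) \<in> ordered_graphs n" using assms(1) e by simp
  have bx: "(relabel (edge_perms n \<gamma>2 (l \<circ> inv' \<pi>2)) G, l \<circ> inv' \<pi>2) \<in> ordered_graphs n"
    by (intro ordered_graphs_relabel x permutes_inv \<pi> bij_edge_perms)
  have lhs: "act_graph n (a \<otimes>\<^bsub>semidirect n\<^esub> b) x = (relabel (edge_perms n ?\<gamma> ?l) G, ?l)"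
    unfolding e semidirect_mult act_graph_relabel(1)[OF x \<pi>12] inv ..
  have rhs: "act_graph n a (act_graph n b x) = (relabel ?\<Phi> G, ?l)"
    unfolding e act_graph_relabel(1)[OF x \<pi>(2)] act_graph_relabel(1)[OF bx \<pi>(1)]
    by (simp only: relabel_relabel[OF bij_edge_perms bij_edge_perms])
  have inj: "inj_on ?l {1..n}" "inj_on (l \<circ> inv' \<pi>2) {1..n}"
    using act_graph_relabel(2)[OF x \<pi>12] act_graph_relabel(2)[OF x \<pi>(2)] unfolding inv by blast+
  have "Klein_eq (?\<Phi> (l i)) (edge_perms n ?\<gamma> ?l (l i))" if i: "i \<in> {1..n}" for i
  proof -
    \<comment> \<open>The position to which the edge of index \<open>i\<close> is moved.\<close>
    define j where "j = \<pi>1 (\<pi>2 i)"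
    have j: "j \<in> {1..n}" "inv' \<pi>1 j \<in> {1..n}" "?l j = l i" "(l \<circ> inv' \<pi>2) (inv' \<pi>1 j) = l i"
      using i \<pi> by (simp_all add: j_def permutes_inverses permutes_in_image del: atLeastAtMost_iff)
    have "?\<Phi> (l i) = op_perm (\<gamma>1 j) \<circ> op_perm (\<gamma>2 (inv' \<pi>1 j))"
      using edge_perms_eq[OF inj(1) j(1), of \<gamma>1] edge_perms_eq[OF inj(2) j(2), of \<gamma>2]
      unfolding j(3,4) by simp
    moreover have "edge_perms n ?\<gamma> ?l (l i) = op_perm (\<gamma>1 j \<otimes>\<^bsub>\<SS>\<^esub> \<gamma>2 (inv' \<pi>1 j))"
      using edge_perms_eq[OF inj(1) j(1), of ?\<gamma>] j(1) unfolding j(3) by simp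
    ultimately show ?thesis using Klein_eq_sym[OF op_perm_mult] by metis
  qed
  moreover have "((G, l), (G, l)) \<in> ordered_iso n"
    using ordered_iso_equiv x by (meson equiv_def refl_onD)
  moreover have "(inv' \<pi>2 \<circ> inv' \<pi>1) permutes {1..n}"
    using \<pi> by (simp add: permutes_compose permutes_inv)
  ultimately have "((relabel (edge_perms n ?\<gamma> ?l) G, l \<circ> (inv' \<pi>2 \<circ> inv' \<pi>1)),
      (relabel ?\<Phi> G, l \<circ> (inv' \<pi>2 \<circ> inv' \<pi>1))) \<in> ordered_iso n"
    by (intro ordered_iso_relabel bij_edge_perms bij_comp)
  then show ?thesis unfolding lhs rhs by (simp only: comp_assoc)
qed

lemma act_class:
  assumes "x \<in> ordered_graphs n" "a \<in> carrier (semidirect n)"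
  shows "act n a (ordered_iso n `` {x}) = ordered_iso n `` {act_graph n a x}"
proof -
  have "(\<lambda>x. ordered_iso n `` {act_graph n a x}) respects ordered_iso n"
    using act_graph_cong[OF _ assms(2)] equiv_class_eq[OF ordered_iso_equiv]
    by (intro congruentI) blast
  from UN_equiv_class[OF ordered_iso_equiv this assms(1)]
  show ?thesis using assms(1) by (simp add: act_def \<G>or_def quotientI)
qed

lemma group_action_act:
  "group_action (semidirect n) (\<G>or n :: 'e ordered_graph set set) (act n)"
proof -
  let ?X = "\<G>or n :: 'e ordered_graph set set"
  interpret group "semidirect n" by (rule group_semidirect)
  have closed: "act n a C \<in> ?X" if "C \<in> ?X" "a \<in> carrier (semidirect n)" for a C
    using that by (auto simp: \<G>or_def act_class intro!: quotientI act_graph_closed elim!: quotientE)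
  have mult: "act n (a \<otimes>\<^bsub>semidirect n\<^esub> b) C = act n a (act n b C)"
    if "C \<in> ?X" "a \<in> carrier (semidirect n)" "b \<in> carrier (semidirect n)" for a b C
  proof -
    obtain x where x: "x \<in> ordered_graphs n" "C = ordered_iso n `` {x}"
      using \<open>C \<in> ?X\<close> unfolding \<G>or_def by (rule quotientE)
    show ?thesis
      using that x equiv_class_eq[OF ordered_iso_equiv act_graph_mult[OF x(1) that(2,3)]]
      by (simp add: act_class act_graph_closed)
  qed
  have one: "act n \<one>\<^bsub>semidirect n\<^esub> C = C" if "C \<in> ?X" for C
  proof -
    obtain x where x: "x \<in> ordered_graphs n" "C = ordered_iso n `` {x}"
      using \<open>C \<in> ?X\<close> unfolding \<G>or_def by (rule quotientE)
    then show ?thesis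
      using equiv_class_eq[OF ordered_iso_equiv act_graph_one[OF x(1)]] by (simp add: act_class)
  qed
  have Bij: "act n a \<in> Bij (?X)" if a: "a \<in> carrier (semidirect n)" for a
  proof -
    have "bij_betw (act n a) (?X) (?X)"
    proof (rule bij_betwI[where g = "act n (inv\<^bsub>semidirect n\<^esub> a)"])
      show "act n a \<in> ?X \<rightarrow> ?X" "act n (inv\<^bsub>semidirect n\<^esub> a) \<in> ?X \<rightarrow> ?X"
        using closed a inv_closed[OF a] by blast+
      fix C assume C: "C \<in> ?X"
      show "act n (inv\<^bsub>semidirect n\<^esub> a) (act n a C) = C"
        using mult[OF C inv_closed[OF a] a] one[OF C] by (simp only: l_inv[OF a])
      show "act n a (act n (inv\<^bsub>semidirect n\<^esub> a) C) = C"
        using mult[OF C a inv_closed[OF a]] one[OF C] by (simp only: r_inv[OF a])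
    qed
    then show ?thesis by (simp add: Bij_def act_def)
  qed
  have "act n (a \<otimes>\<^bsub>semidirect n\<^esub> b) = act n a \<otimes>\<^bsub>BijGroup (?X)\<^esub> act n b"
    if "a \<in> carrier (semidirect n)" "b \<in> carrier (semidirect n)" for a b
  proof
    fix C
    have "act n c C = undefined" if "C \<notin> ?X" for c
      using that by (simp add: act_def)
    then show "act n (a \<otimes>\<^bsub>semidirect n\<^esub> b) C = (act n a \<otimes>\<^bsub>BijGroup (?X)\<^esub> act n b) C"
      using Bij[OF that(1)] Bij[OF that(2)] mult[OF _ that] by (cases "C \<in> ?X") (simp_all add: BijGroup_def compose_def)
  qed
  then show ?thesis
    using Bij by (intro group_action.intro group_hom.intro group_hom_axioms.intro homI group_BijGroup group_semidirect)
      (auto simp: BijGroup_def)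
qed

section \<open>Conjugacy in the group of ribbon operations\<close>

lemma (in group) intertwine_pow:
  assumes "k \<in> carrier G" "x \<in> carrier G" "y \<in> carrier G" "k \<otimes> x = y \<otimes> k"
  shows "k \<otimes> x [^] (n :: nat) = y [^] n \<otimes> k"
proof (induction n)
  case (Suc n)
  have "k \<otimes> x [^] Suc n = (k \<otimes> x [^] n) \<otimes> x"
    using assms by (simp add: m_assoc)
  also have "\<dots> = y [^] n \<otimes> (k \<otimes> x)"
    using assms by (simp add: Suc m_assoc)
  also have "\<dots> = y [^] Suc n \<otimes> k"
    using assms by (simp add: m_assoc)
  finally show ?case .
qed (use assms in simp)

lemma (in group) ord_eq_if_intertwined:
  assumes "k \<in> carrier G" "x \<in> carrier G" "y \<in> carrier G" "k \<otimes> x = y \<otimes> k"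
  shows "ord x = ord y"
proof -
  have "x [^] n = \<one> \<longleftrightarrow> y [^] n = \<one>" for n :: nat
  proof -
    have "y [^] n = \<one> \<longleftrightarrow> y [^] n \<otimes> k = \<one> \<otimes> k"
      using assms by (simp del: l_one)
    also have "\<dots> \<longleftrightarrow> k \<otimes> x [^] n = k \<otimes> \<one>"
      using assms by (simp add: intertwine_pow[OF assms])
    also have "\<dots> \<longleftrightarrow> x [^] n = \<one>"
      using assms by (simp del: r_one)
    finally show ?thesis by blast
  qed
  then show ?thesis using assms by (metis dvd_antisym dvd_refl pow_eq_id)
qed

text \<open>Written without inverses, since the products around cycles appear in this form.\<close>

definition conjugate :: "ribbon_op \<Rightarrow> ribbon_op \<Rightarrow> bool" where
  "conjugate x y \<longleftrightarrow> (\<exists>k. k \<otimes>\<^bsub>\<SS>\<^esub> x = y \<otimes>\<^bsub>\<SS>\<^esub> k)"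

lemma conjugate_refl: "conjugate x x"
  unfolding conjugate_def by blast

lemma conjugate_sym: "conjugate x y \<Longrightarrow> conjugate y x"
proof -
  assume "conjugate x y"
  then obtain k where k: "k \<otimes>\<^bsub>\<SS>\<^esub> x = y \<otimes>\<^bsub>\<SS>\<^esub> k" unfolding conjugate_def by blast
  have "inv\<^bsub>\<SS>\<^esub> k \<otimes>\<^bsub>\<SS>\<^esub> (k \<otimes>\<^bsub>\<SS>\<^esub> x) \<otimes>\<^bsub>\<SS>\<^esub> inv\<^bsub>\<SS>\<^esub> k = inv\<^bsub>\<SS>\<^esub> k \<otimes>\<^bsub>\<SS>\<^esub> (y \<otimes>\<^bsub>\<SS>\<^esub> k) \<otimes>\<^bsub>\<SS>\<^esub> inv\<^bsub>\<SS>\<^esub> k"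
    by (simp only: k)
  then have "inv\<^bsub>\<SS>\<^esub> k \<otimes>\<^bsub>\<SS>\<^esub> y = x \<otimes>\<^bsub>\<SS>\<^esub> inv\<^bsub>\<SS>\<^esub> k"
    by (simp add: S.m_assoc S.inv_solve_left')
  then show "conjugate y x" unfolding conjugate_def by blast
qed

lemma conjugate_trans: "conjugate x y \<Longrightarrow> conjugate y z \<Longrightarrow> conjugate x z"
proof -
  assume "conjugate x y" "conjugate y z"
  then obtain k k' where k: "k \<otimes>\<^bsub>\<SS>\<^esub> x = y \<otimes>\<^bsub>\<SS>\<^esub> k" "k' \<otimes>\<^bsub>\<SS>\<^esub> y = z \<otimes>\<^bsub>\<SS>\<^esub> k'"
    unfolding conjugate_def by blast
  have "k' \<otimes>\<^bsub>\<SS>\<^esub> k \<otimes>\<^bsub>\<SS>\<^esub> x = k' \<otimes>\<^bsub>\<SS>\<^esub> y \<otimes>\<^bsub>\<SS>\<^esub> k"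
    by (simp add: S.m_assoc k(1))
  also have "\<dots> = z \<otimes>\<^bsub>\<SS>\<^esub> (k' \<otimes>\<^bsub>\<SS>\<^esub> k)"
    by (simp add: S.m_assoc k(2))
  finally show "conjugate x z" unfolding conjugate_def by blast
qed

definition op_delta :: ribbon_op where "op_delta = abs_ribbon_op [Delta]"
definition op_tau :: ribbon_op where "op_tau = abs_ribbon_op [Tau]"

lemma mult_abs: "abs_ribbon_op u \<otimes>\<^bsub>\<SS>\<^esub> abs_ribbon_op v = abs_ribbon_op (u @ v)"
  by (simp add: ribbon_group_ops_def ribbon_op_mult.abs_eq)

lemma abs_relator: "r \<in> relators \<Longrightarrow> abs_ribbon_op r = \<one>\<^bsub>\<SS>\<^esub>"
  using word_eq.cancel[of r "[]" "[]"]
  by (simp add: ribbon_group_ops_def ribbon_op_one_def ribbon_op.abs_eq_iff)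

lemma op_relations:
  "op_delta \<otimes>\<^bsub>\<SS>\<^esub> op_delta = \<one>\<^bsub>\<SS>\<^esub>" "op_tau \<otimes>\<^bsub>\<SS>\<^esub> op_tau = \<one>\<^bsub>\<SS>\<^esub>"
  "op_tau \<otimes>\<^bsub>\<SS>\<^esub> (op_delta \<otimes>\<^bsub>\<SS>\<^esub> op_tau) = op_delta \<otimes>\<^bsub>\<SS>\<^esub> (op_tau \<otimes>\<^bsub>\<SS>\<^esub> op_delta)"
proof -
  show dd: "op_delta \<otimes>\<^bsub>\<SS>\<^esub> op_delta = \<one>\<^bsub>\<SS>\<^esub>" and tt: "op_tau \<otimes>\<^bsub>\<SS>\<^esub> op_tau = \<one>\<^bsub>\<SS>\<^esub>"
    by (simp_all add: op_delta_def op_tau_def mult_abs abs_relator relators_def)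
  have "op_tau \<otimes>\<^bsub>\<SS>\<^esub> (op_delta \<otimes>\<^bsub>\<SS>\<^esub> op_tau) \<otimes>\<^bsub>\<SS>\<^esub> (op_delta \<otimes>\<^bsub>\<SS>\<^esub> (op_tau \<otimes>\<^bsub>\<SS>\<^esub> op_delta)) = \<one>\<^bsub>\<SS>\<^esub>"
    by (simp add: op_delta_def op_tau_def mult_abs abs_relator relators_def)
  moreover have "(op_delta \<otimes>\<^bsub>\<SS>\<^esub> (op_tau \<otimes>\<^bsub>\<SS>\<^esub> op_delta)) \<otimes>\<^bsub>\<SS>\<^esub> (op_delta \<otimes>\<^bsub>\<SS>\<^esub> (op_tau \<otimes>\<^bsub>\<SS>\<^esub> op_delta)) = \<one>\<^bsub>\<SS>\<^esub>"
    by (metis S.m_assoc S.l_one S.r_one in_carrier dd tt)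
  ultimately show "op_tau \<otimes>\<^bsub>\<SS>\<^esub> (op_delta \<otimes>\<^bsub>\<SS>\<^esub> op_tau) = op_delta \<otimes>\<^bsub>\<SS>\<^esub> (op_tau \<otimes>\<^bsub>\<SS>\<^esub> op_delta)"
    by (metis S.right_cancel in_carrier)
qed

lemma op_reduce:
  "op_delta \<otimes>\<^bsub>\<SS>\<^esub> (op_delta \<otimes>\<^bsub>\<SS>\<^esub> x) = x" "op_tau \<otimes>\<^bsub>\<SS>\<^esub> (op_tau \<otimes>\<^bsub>\<SS>\<^esub> x) = x"
  "op_tau \<otimes>\<^bsub>\<SS>\<^esub> (op_delta \<otimes>\<^bsub>\<SS>\<^esub> (op_tau \<otimes>\<^bsub>\<SS>\<^esub> x)) = op_delta \<otimes>\<^bsub>\<SS>\<^esub> (op_tau \<otimes>\<^bsub>\<SS>\<^esub> (op_delta \<otimes>\<^bsub>\<SS>\<^esub> x))"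
  using op_relations by (metis S.m_assoc S.l_one in_carrier)+

text \<open>Words reduce to one of six, and those other than the identity fall into two classes: the
  conjugates of \<open>\<delta>\<close>, which are killed by squaring, and the conjugates of \<open>\<delta>\<tau>\<close>, which are killed
  by cubing.\<close>

lemma op_cases:
  obtains (identity) "x = \<one>\<^bsub>\<SS>\<^esub>"
  | (reflection) "conjugate op_delta x" "x [^]\<^bsub>\<SS>\<^esub> (2 :: nat) = \<one>\<^bsub>\<SS>\<^esub>"
  | (rotation) "conjugate (op_delta \<otimes>\<^bsub>\<SS>\<^esub> op_tau) x" "x [^]\<^bsub>\<SS>\<^esub> (3 :: nat) = \<one>\<^bsub>\<SS>\<^esub>"
proof -
  let ?d = op_delta and ?t = op_tau
  note red = op_relations op_reduce S.m_assoc
  have "abs_ribbon_op w \<in> {\<one>\<^bsub>\<SS>\<^esub>, ?d, ?t, ?d \<otimes>\<^bsub>\<SS>\<^esub> ?t, ?t \<otimes>\<^bsub>\<SS>\<^esub> ?d, ?d \<otimes>\<^bsub>\<SS>\<^esub> (?t \<otimes>\<^bsub>\<SS>\<^esub> ?d)}" for w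
  proof (induction w)
    case Nil
    then show ?case by (simp add: ribbon_group_ops_def ribbon_op_one_def)
  next
    case (Cons y w)
    have "abs_ribbon_op (y # w) = (case y of Delta \<Rightarrow> ?d | Tau \<Rightarrow> ?t) \<otimes>\<^bsub>\<SS>\<^esub> abs_ribbon_op w"
      by (cases y) (simp_all add: op_delta_def op_tau_def mult_abs)
    with Cons show ?case by (cases y) (auto simp: red)
  qed
  from this[of "rep_ribbon_op x"]
  have "x \<in> {\<one>\<^bsub>\<SS>\<^esub>, ?d, ?t, ?d \<otimes>\<^bsub>\<SS>\<^esub> ?t, ?t \<otimes>\<^bsub>\<SS>\<^esub> ?d, ?d \<otimes>\<^bsub>\<SS>\<^esub> (?t \<otimes>\<^bsub>\<SS>\<^esub> ?d)}"
    by (simp add: Quotient3_abs_rep[OF Quotient3_ribbon_op])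
  moreover have "conjugate ?d ?t"
    unfolding conjugate_def by (rule exI[of _ "?d \<otimes>\<^bsub>\<SS>\<^esub> ?t"]) (simp add: red)
  moreover have "conjugate ?d (?d \<otimes>\<^bsub>\<SS>\<^esub> (?t \<otimes>\<^bsub>\<SS>\<^esub> ?d))"
    unfolding conjugate_def by (rule exI[of _ ?t]) (simp add: red)
  moreover have "conjugate (?d \<otimes>\<^bsub>\<SS>\<^esub> ?t) (?t \<otimes>\<^bsub>\<SS>\<^esub> ?d)"
    unfolding conjugate_def by (rule exI[of _ ?d]) (simp add: red)
  ultimately show ?thesis
    using identity reflection rotation
    by (auto simp: conjugate_refl numeral_2_eq_2 numeral_3_eq_3 red)
qed

text \<open>This converts the hypothesis on orders into something constructive.  If a
  reflection and a rotation have the same order, it divides both 2 and 3, so both are the identity;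
  and an element with the order of the identity is the identity.  Within either class the claim holds
  by \<open>op_cases\<close>.\<close>

lemma conjugate_if_same_ord:
  assumes "group.ord \<SS> x = group.ord \<SS> y"
  shows "conjugate x y"
proof -
  have trivial: "conjugate x y" if "S.ord x = 1"
  proof -
    have "x = \<one>\<^bsub>\<SS>\<^esub>" "y = \<one>\<^bsub>\<SS>\<^esub>" using that assms S.ord_eq_1[of x] S.ord_eq_1[of y] by simp_all
    then show ?thesis by (simp add: conjugate_refl)
  qed
  have coprime: "conjugate x y" if "S.ord x dvd 2" "S.ord x dvd 3"
  proof -
    have "S.ord x dvd 3 - 2" using that by (rule dvd_diff_nat[rotated])
    then show ?thesis by (intro trivial) simp
  qed
  have dvd: "z [^]\<^bsub>\<SS>\<^esub> (k :: nat) = \<one>\<^bsub>\<SS>\<^esub> \<Longrightarrow> S.ord z dvd k" for z k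
    by (simp add: S.pow_eq_id)
  show ?thesis
  proof (cases x rule: op_cases)
    case identity
    then show ?thesis by (intro trivial) simp
  next
    case x: reflection
    show ?thesis
    proof (cases y rule: op_cases)
      case identity
      then show ?thesis using assms by (intro trivial) simp
    next
      case reflection
      then show ?thesis using x conjugate_sym conjugate_trans by blast
    next
      case rotation
      then show ?thesis using dvd[OF x(2)] dvd[OF rotation(2)] assms by (intro coprime) simp_all
    qed
  next
    case x: rotation
    show ?thesis
    proof (cases y rule: op_cases)
      case identity
      then show ?thesis using assms by (intro trivial) simp
    next
      case rotation
      then show ?thesis using x conjugate_sym conjugate_trans by blast
    next
      case reflection
      then show ?thesis using dvd[OF x(2)] dvd[OF reflection(2)] assms by (intro coprime) simp_all
    qed
  qed
qed

section \<open>Products along cycles\<close>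

text \<open>This says that \<open>\<xi>\<close> is the constant family \<open>g\<close> twisted by \<open>\<gamma>\<close>, namely
  \<open>\<xi> (\<mu> i) = \<gamma> (\<mu> i) g (\<gamma> i)\<^sup>-\<^sup>1\<close>, so that conjugation by \<open>\<gamma>\<close> turns one into the other in the
  semidirect product.\<close>

definition intertwines :: "nat \<Rightarrow> (nat \<Rightarrow> ribbon_op) \<Rightarrow> ribbon_op \<Rightarrow> (nat \<Rightarrow> ribbon_op) \<Rightarrow> (nat \<Rightarrow> nat) \<Rightarrow> bool" where
  "intertwines n \<gamma> g \<xi> \<mu> \<longleftrightarrow> (\<forall>i\<in>{1..n}. \<gamma> (\<mu> i) \<otimes>\<^bsub>\<SS>\<^esub> g = \<xi> (\<mu> i) \<otimes>\<^bsub>\<SS>\<^esub> \<gamma> i)"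

lemma reverse_product_snoc: "reverse_product \<xi> (c @ [a]) = \<xi> a \<otimes>\<^bsub>\<SS>\<^esub> reverse_product \<xi> c"
  by (simp add: reverse_product_def)

text \<open>In \<open>\<xi>(x\<^sub>m) \<cdots> \<xi>(x\<^sub>1) = (\<gamma>(x\<^sub>m) g \<gamma>(x\<^sub>m\<^sub>-\<^sub>1)\<^sup>-\<^sup>1) \<cdots> (\<gamma>(x\<^sub>1) g \<gamma>(x\<^sub>0)\<^sup>-\<^sup>1)\<close> the inner factors cancel.\<close>

lemma reverse_product_telescope:
  assumes "\<And>j. j < m \<Longrightarrow> \<gamma> (x (Suc j)) \<otimes>\<^bsub>\<SS>\<^esub> g = \<xi> (x (Suc j)) \<otimes>\<^bsub>\<SS>\<^esub> \<gamma> (x j)"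
  shows "\<gamma> (x m) \<otimes>\<^bsub>\<SS>\<^esub> g [^]\<^bsub>\<SS>\<^esub> m = reverse_product \<xi> (map (\<lambda>j. x (Suc j)) [0..<m]) \<otimes>\<^bsub>\<SS>\<^esub> \<gamma> (x 0)"
  using assms
proof (induction m)
  case 0
  then show ?case by (simp add: reverse_product_def)
next
  case (Suc m)
  have "\<gamma> (x (Suc m)) \<otimes>\<^bsub>\<SS>\<^esub> g [^]\<^bsub>\<SS>\<^esub> Suc m = (\<gamma> (x (Suc m)) \<otimes>\<^bsub>\<SS>\<^esub> g) \<otimes>\<^bsub>\<SS>\<^esub> g [^]\<^bsub>\<SS>\<^esub> m"
    by (simp only: S.nat_pow_Suc2 in_carrier S.m_assoc)
  also have "\<dots> = \<xi> (x (Suc m)) \<otimes>\<^bsub>\<SS>\<^esub> (\<gamma> (x m) \<otimes>\<^bsub>\<SS>\<^esub> g [^]\<^bsub>\<SS>\<^esub> m)"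
    by (simp only: Suc.prems[OF lessI] S.m_assoc in_carrier)
  also have "\<gamma> (x m) \<otimes>\<^bsub>\<SS>\<^esub> g [^]\<^bsub>\<SS>\<^esub> m = reverse_product \<xi> (map (\<lambda>j. x (Suc j)) [0..<m]) \<otimes>\<^bsub>\<SS>\<^esub> \<gamma> (x 0)"
    by (rule Suc.IH) (simp add: Suc.prems)
  finally show ?case by (simp add: reverse_product_snoc S.m_assoc)
qed

text \<open>Starting the orbit at the last entry, the predecessor of the first, makes the whole list a
  telescoping product.\<close>

lemma cycle_as_orbit:
  assumes "is_cycle_of n \<mu> c"
  shows "c = map (\<lambda>j. (\<mu> ^^ Suc j) (last c)) [0..<length c]" and "(\<mu> ^^ length c) (last c) = last c"
proof -
  have ne: "c \<noteq> []" and step: "\<And>i. i < length c \<Longrightarrow> \<mu> (c ! i) = c ! (Suc i mod length c)"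
    using assms by (auto simp: is_cycle_of_def)
  have *: "j < length c \<Longrightarrow> c ! j = (\<mu> ^^ Suc j) (last c)" for j
  proof (induction j)
    case 0
    then show ?case using ne step[of "length c - 1"] by (simp add: last_conv_nth)
  next
    case (Suc j)
    then show ?case using step[of j] by simp
  qed
  then show "c = map (\<lambda>j. (\<mu> ^^ Suc j) (last c)) [0..<length c]"
    by (intro nth_equalityI) simp_all
  show "(\<mu> ^^ length c) (last c) = last c"
    using *[of "length c - 1"] ne by (simp add: last_conv_nth del: funpow.simps)
qed

text \<open>Around a cycle the telescope closes up and exhibits the product of \<open>\<xi>\<close> as a conjugate of \<open>g\<^sup>m\<close>.\<close>

lemma cycle_ord_if_intertwines:
  assumes \<mu>: "\<mu> permutes {1..n}" and \<gamma>: "intertwines n \<gamma> g \<xi> \<mu>"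
  shows "cycle_ord_property n g \<xi> \<mu>"
  unfolding cycle_ord_property_def
proof (intro allI impI)
  fix c assume c: "is_cycle_of n \<mu> c"
  let ?x = "\<lambda>j. (\<mu> ^^ j) (last c)"
  have last: "last c \<in> {1..n}" using c last_in_set[of c] unfolding is_cycle_of_def by blast
  have "?x j \<in> {1..n}" for j
    using permutes_in_image[OF \<mu>] last by (induction j) (simp_all del: atLeastAtMost_iff)
  with \<gamma> have "\<gamma> (?x (Suc j)) \<otimes>\<^bsub>\<SS>\<^esub> g = \<xi> (?x (Suc j)) \<otimes>\<^bsub>\<SS>\<^esub> \<gamma> (?x j)" for j
    by (simp add: intertwines_def)
  from reverse_product_telescope[of "length c" \<gamma> ?x g \<xi>, OF this]
  have "\<gamma> (last c) \<otimes>\<^bsub>\<SS>\<^esub> g [^]\<^bsub>\<SS>\<^esub> length c = reverse_product \<xi> c \<otimes>\<^bsub>\<SS>\<^esub> \<gamma> (last c)"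
    using cycle_as_orbit[OF c] by (simp del: funpow.simps)
  then show "S.ord (reverse_product \<xi> c) = S.ord (g [^]\<^bsub>\<SS>\<^esub> length c)"
    by (intro S.ord_eq_if_intertwined[symmetric, of "\<gamma> (last c)"]) simp_all
qed

text \<open>The list starts at \<open>\<mu> r\<close> rather than \<open>r\<close> to match the telescoping product.\<close>

lemma support_shift_is_cycle:
  assumes \<mu>: "\<mu> permutes {1..n}" and r: "r \<in> {1..n}"
  shows "is_cycle_of n \<mu> (map (\<lambda>j. (\<mu> ^^ Suc j) r) [0..<least_power \<mu> r])"
proof -
  let ?m = "least_power \<mu> r"
  have perm: "permutation \<mu>" using \<mu> by (auto simp: permutation_permutes)
  have pos: "?m > 0" and period: "(\<mu> ^^ ?m) r = r"
    using least_power_of_permutation[OF perm] by auto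
  have dist: "distinct (support \<mu> r)" by (rule cycle_of_permutation[OF perm])
  have "distinct (map \<mu> (support \<mu> r))"
    using dist permutes_inj[OF \<mu>] by (simp only: distinct_map) (blast intro: inj_on_subset)
  then have "distinct (map (\<lambda>j. (\<mu> ^^ Suc j) r) [0..<?m])"
    by (simp add: comp_def)
  moreover have "(\<mu> ^^ j) r \<in> {1..n}" for j
    using permutes_in_image[OF \<mu>] r by (induction j) (simp_all del: atLeastAtMost_iff)
  moreover have "\<mu> ((\<mu> ^^ Suc i) r) = (\<mu> ^^ Suc (Suc i mod ?m)) r" if "i < ?m" for i
  proof (cases "Suc i = ?m")
    case True
    then show ?thesis using period by simp
  qed (use that in simp)
  ultimately show ?thesis
    using pos unfolding is_cycle_of_def by (auto simp del: funpow.simps)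
qed

text \<open>On each cycle \<open>\<gamma>\<close> is forced by its value \<open>k\<close> at one point \<open>r\<close>: after \<open>j\<close> steps it is
  \<open>\<xi>(\<mu>\<^sup>j r) \<cdots> \<xi>(\<mu> r) k g\<^sup>-\<^sup>j\<close>.  Returning to \<open>r\<close> after \<open>m\<close> steps gives the value \<open>k\<close> again exactly
  if \<open>k\<close> conjugates \<open>g\<^sup>m\<close> to the product of \<open>\<xi>\<close> around the cycle.  Such a \<open>k\<close> exists because the
  two have the same order.\<close>

lemma intertwines_if_cycle_ord:
  assumes \<mu>: "\<mu> permutes {1..n}" and cyc: "cycle_ord_property n g \<xi> \<mu>"
  obtains \<gamma> where "intertwines n \<gamma> g \<xi> \<mu>"
proof -
  have perm: "permutation \<mu>" using \<mu> by (auto simp: permutation_permutes)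
  define m where "m = least_power \<mu>"
  define P where "P r j = reverse_product \<xi> (map (\<lambda>i. (\<mu> ^^ Suc i) r) [0..<j])" for r j
  have P_Suc: "P r (Suc j) = \<xi> ((\<mu> ^^ Suc j) r) \<otimes>\<^bsub>\<SS>\<^esub> P r j" for r j
    by (simp add: P_def reverse_product_snoc)
  have "\<exists>k. k \<otimes>\<^bsub>\<SS>\<^esub> g [^]\<^bsub>\<SS>\<^esub> m r = P r (m r) \<otimes>\<^bsub>\<SS>\<^esub> k" if "r \<in> {1..n}" for r
  proof -
    have "S.ord (g [^]\<^bsub>\<SS>\<^esub> m r) = S.ord (P r (m r))"
      using cyc support_shift_is_cycle[OF \<mu> that] unfolding cycle_ord_property_def P_def m_def
      by (metis length_map length_upt minus_nat.diff_0)
    then show ?thesis using conjugate_if_same_ord unfolding conjugate_def by blast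
  qed
  then obtain k where k: "\<And>r. r \<in> {1..n} \<Longrightarrow> k r \<otimes>\<^bsub>\<SS>\<^esub> g [^]\<^bsub>\<SS>\<^esub> m r = P r (m r) \<otimes>\<^bsub>\<SS>\<^esub> k r"
    by metis
  define v where "v r j = P r j \<otimes>\<^bsub>\<SS>\<^esub> k r \<otimes>\<^bsub>\<SS>\<^esub> inv\<^bsub>\<SS>\<^esub> (g [^]\<^bsub>\<SS>\<^esub> j)" for r j
  have v_Suc: "v r (Suc j) \<otimes>\<^bsub>\<SS>\<^esub> g = \<xi> ((\<mu> ^^ Suc j) r) \<otimes>\<^bsub>\<SS>\<^esub> v r j" for r j
    unfolding v_def P_Suc S.nat_pow_Suc2[OF in_carrier]
    by (simp add: S.m_assoc S.inv_mult_group)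
  have v_period: "v r (m r) = v r 0" if "r \<in> {1..n}" for r
    using k[OF that, symmetric] by (simp add: v_def S.m_assoc P_def reverse_product_def)
  define orb where "orb i = range (\<lambda>j. (\<mu> ^^ j) i)" for i
  have orb_support: "orb i = (\<lambda>j. (\<mu> ^^ j) i) ` {0..<m i}" for i
    using support_set[OF perm, of i] by (simp add: orb_def m_def)
  have orb_step: "orb (\<mu> i) = orb i" for i
  proof
    show "orb (\<mu> i) \<subseteq> orb i"
      unfolding orb_def by (auto simp: funpow_swap1 intro: range_eqI[of _ _ "Suc _"])
    have "(\<mu> ^^ j) i \<in> orb (\<mu> i)" for j
    proof -
      have "(\<mu> ^^ j) i = (\<mu> ^^ j) ((\<mu> ^^ m i) i)"
        using least_power_of_permutation[OF perm] by (simp add: m_def)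
      also have "m i = Suc (m i - 1)"
        using least_power_of_permutation[OF perm] by (simp add: m_def)
      also have "(\<mu> ^^ j) ((\<mu> ^^ Suc (m i - 1)) i) = (\<mu> ^^ (j + (m i - 1))) (\<mu> i)"
        by (simp add: funpow_add funpow_swap1)
      finally show ?thesis by (simp add: orb_def)
    qed
    then show "orb i \<subseteq> orb (\<mu> i)" by (auto simp: orb_def)
  qed
  have orb_eq: "orb x = orb i" if "x \<in> orb i" for x i
  proof -
    have "orb ((\<mu> ^^ j) i) = orb i" for j by (induction j) (simp_all add: orb_step)
    with that show ?thesis by (auto simp: orb_def)
  qed
  have self: "i \<in> orb i" for i unfolding orb_def by (rule range_eqI[of _ _ 0]) simp
  \<comment> \<open>One starting point is chosen on each cycle, as the least element, and \<open>t i\<close> is the number of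
    steps from it to \<open>i\<close>.\<close>
  define rep where "rep i = (LEAST x. x \<in> orb i)" for i
  have rep_orb: "rep i \<in> orb i" for i unfolding rep_def using self by (rule LeastI)
  have rep_step: "rep (\<mu> i) = rep i" for i by (simp add: rep_def orb_step)
  have "\<exists>j<m (rep i). (\<mu> ^^ j) (rep i) = i" for i
    using self[of i] orb_eq[OF rep_orb, of i] orb_support[of "rep i"] by force
  then obtain t where t: "\<And>i. t i < m (rep i)" "\<And>i. (\<mu> ^^ t i) (rep i) = i" by metis
  have inj: "inj_on (\<lambda>j. (\<mu> ^^ j) r) {0..<m r}" for r
    using cycle_of_permutation[OF perm, of r] by (simp add: distinct_map m_def)
  have "v (rep (\<mu> i)) (t (\<mu> i)) = v (rep i) (Suc (t i))" if i: "i \<in> {1..n}" for i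
  proof -
    have in_range: "rep i \<in> {1..n}"
    proof -
      have "(\<mu> ^^ j) i \<in> {1..n}" for j
        using permutes_in_image[OF \<mu>] i by (induction j) (simp_all del: atLeastAtMost_iff)
      then show ?thesis using rep_orb[of i] by (auto simp: orb_def simp del: atLeastAtMost_iff)
    qed
    have eq: "(\<mu> ^^ t (\<mu> i)) (rep i) = (\<mu> ^^ Suc (t i)) (rep i)"
      using t(2)[of i] t(2)[of "\<mu> i"] by (simp add: rep_step)
    show ?thesis
    \<comment> \<open>Either the step from \<open>i\<close> to \<open>\<mu> i\<close> closes the cycle, or it is an ordinary step.\<close>
    proof (cases "Suc (t i) = m (rep i)")
      case True
      then have "(\<mu> ^^ t (\<mu> i)) (rep i) = (\<mu> ^^ 0) (rep i)"
        using eq least_power_of_permutation(1)[OF perm] by (simp add: m_def del: funpow.simps(2))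
      then have "t (\<mu> i) = 0"
        using inj_onD[OF inj[of "rep i"], of "t (\<mu> i)" 0] t(1)[of i] t(1)[of "\<mu> i"] by (simp add: rep_step)
      then show ?thesis using v_period[OF in_range] True by (simp add: rep_step)
    next
      case False
      then have "t (\<mu> i) = Suc (t i)"
        using inj_onD[OF inj[of "rep i"] eq] t(1)[of i] t(1)[of "\<mu> i"] by (simp add: rep_step)
      then show ?thesis by (simp add: rep_step)
    qed
  qed
  then have "intertwines n (\<lambda>i. v (rep i) (t i)) g \<xi> \<mu>"
    using v_Suc t(2) by (simp add: intertwines_def)
  then show thesis by (rule that)
qed

section \<open>Transport of symmetries along an orbit\<close>

text \<open>If \<open>b' = a b a\<^sup>-\<^sup>1\<close> then \<open>a\<close> carries the fixed points of \<open>b\<close> bijectively to those of \<open>b'\<close>.\<close>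

lemma fixed_transport:
  fixes H :: "'e ordered_graph set"
  assumes "H \<in> \<G>or n" "a \<in> carrier (semidirect n)"
    and "b \<in> carrier (semidirect n)" "b' \<in> carrier (semidirect n)"
    and "a \<otimes>\<^bsub>semidirect n\<^esub> b = b' \<otimes>\<^bsub>semidirect n\<^esub> a"
  shows "act n b H = H \<longleftrightarrow> act n b' (act n a H) = act n a H"
proof -
  interpret group_action "semidirect n" "\<G>or n :: 'e ordered_graph set set" "act n"
    by (rule group_action_act)
  have "act n b' (act n a H) = act n a (act n b H)"
    using composition_rule[OF assms(1,2,3)] composition_rule[OF assms(1,4,2)] assms(5) by simp
  moreover have "act n b H \<in> \<G>or n" using element_image[OF assms(3,1)] by blast
  ultimately show ?thesis using inj_on_eq_iff[OF inj_prop[OF assms(2)], of "act n b H" H] assms(1) by simp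
qed

lemma semidirect_intertwine:
  assumes "\<gamma> \<in> extensional {1..n}" "\<pi> permutes {1..n}" "\<mu> permutes {1..n}"
    and "intertwines n \<gamma> g \<xi> (\<pi> \<circ> \<mu> \<circ> inv' \<pi>)"
  shows "(\<gamma>, \<pi>) \<otimes>\<^bsub>semidirect n\<^esub> ((\<lambda>i\<in>{1..n}. g), \<mu>)
    = (\<xi>, \<pi> \<circ> \<mu> \<circ> inv' \<pi>) \<otimes>\<^bsub>semidirect n\<^esub> (\<gamma>, \<pi>)"
proof -
  let ?\<mu>' = "\<pi> \<circ> \<mu> \<circ> inv' \<pi>"
  have \<mu>': "?\<mu>' permutes {1..n}"
    using assms(2,3) by (intro permutes_compose permutes_inv)
  have "\<gamma> i \<otimes>\<^bsub>\<SS>\<^esub> g = \<xi> i \<otimes>\<^bsub>\<SS>\<^esub> \<gamma> (inv' ?\<mu>' i)" if "i \<in> {1..n}" for i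
  proof -
    have "inv' ?\<mu>' i \<in> {1..n}" using permutes_in_image[OF permutes_inv[OF \<mu>']] that by blast
    moreover have "?\<mu>' (inv' ?\<mu>' i) = i" by (rule permutes_inverses(1)[OF \<mu>'])
    ultimately show ?thesis using assms(4) unfolding intertwines_def by metis
  qed
  moreover have "inv' \<pi> i \<in> {1..n}" if "i \<in> {1..n}" for i
    using permutes_in_image[OF permutes_inv[OF assms(2)]] that by blast
  moreover have "\<pi> \<circ> \<mu> = ?\<mu>' \<circ> \<pi>"
    using permutes_inv_o(2)[OF assms(2)] by (simp add: comp_assoc)
  ultimately show ?thesis
    unfolding semidirect_mult by (auto simp: restrict_def fun_eq_iff)
qed

section \<open>Self-dual, -Petrial, -Wilsonial and -trial graphs in an orbit\<close>

theorem theorem5p5: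
  fixes n :: nat
    and F :: "'e ordered_graph set"
    and g :: ribbon_op
    and \<mu> :: "nat \<Rightarrow> nat"
  assumes "1 \<le> n"
    and "F \<in> \<G>or n"
    and "g \<in> carrier \<SS>"
    and "\<mu> \<in> carrier (sym_group n)"
  shows "((\<exists>H\<in>Orb n F. self_via n (\<lambda>i\<in>{1..n}. g) \<mu> H)
          \<longleftrightarrow>
          (\<forall>G\<in>Orb n F. \<exists>\<xi>\<in>carrier (ops_power n). \<exists>\<pi>\<in>carrier (sym_group n).
             self_via n \<xi> (\<pi> \<circ> \<mu> \<circ> inv' \<pi>) G \<and> cycle_ord_property n g \<xi> (\<pi> \<circ> \<mu> \<circ> inv' \<pi>)))
         \<and>
         ((\<forall>G\<in>Orb n F. \<exists>\<xi>\<in>carrier (ops_power n). \<exists>\<pi>\<in>carrier (sym_group n).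
             self_via n \<xi> (\<pi> \<circ> \<mu> \<circ> inv' \<pi>) G \<and> cycle_ord_property n g \<xi> (\<pi> \<circ> \<mu> \<circ> inv' \<pi>))
          \<longleftrightarrow>
          (\<exists>G\<in>Orb n F. \<exists>\<xi>\<in>carrier (ops_power n). \<exists>\<pi>\<in>carrier (sym_group n).
             self_via n \<xi> (\<pi> \<circ> \<mu> \<circ> inv' \<pi>) G \<and> cycle_ord_property n g \<xi> (\<pi> \<circ> \<mu> \<circ> inv' \<pi>)))"
proof -
  interpret act: group_action "semidirect n" "\<G>or n :: 'e ordered_graph set set" "act n"
    by (rule group_action_act)
  interpret A: group "semidirect n" by (rule group_semidirect)
  let ?orb = "Orb n F"
  let ?good = "\<lambda>G. \<exists>\<xi>\<in>carrier (ops_power n). \<exists>\<pi>\<in>carrier (sym_group n).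
    self_via n \<xi> (\<pi> \<circ> \<mu> \<circ> inv' \<pi>) G \<and> cycle_ord_property n g \<xi> (\<pi> \<circ> \<mu> \<circ> inv' \<pi>)"
  let ?b = "(\<lambda>i\<in>{1..n}. g, \<mu>)"
  have \<mu>: "\<mu> permutes {1..n}" using assms(4) by (simp add: sym_group_carrier)
  have b: "?b \<in> carrier (semidirect n)"
    unfolding semidirect_carrier ops_power_carrier using \<mu> by simp
  have conj: "(\<pi> \<circ> \<mu> \<circ> inv' \<pi>) permutes {1..n}" if "\<pi> permutes {1..n}" for \<pi>
    using \<mu> that by (intro permutes_compose permutes_inv)
  have orbD: "G \<in> \<G>or n \<and> (\<exists>a\<in>carrier (semidirect n). act n a F = G)" if "G \<in> ?orb" for G
    using that act.element_image[OF _ assms(2)] unfolding Orb_def orbit_def by blast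
  have orb_act: "act n a G \<in> ?orb" if G: "G \<in> ?orb" and a: "a \<in> carrier (semidirect n)" for a G
  proof -
    obtain c where c: "c \<in> carrier (semidirect n)" "act n c F = G" using orbD[OF G] by blast
    then have "act n a G = act n (a \<otimes>\<^bsub>semidirect n\<^esub> c) F"
      using act.composition_rule[OF assms(2) a c(1)] by simp
    then show ?thesis using A.m_closed[OF a c(1)] unfolding Orb_def orbit_def by blast
  qed
  have connected: "\<exists>a\<in>carrier (semidirect n). act n a H = G" if H: "H \<in> ?orb" and G: "G \<in> ?orb" for H G
  proof -
    obtain c d where c: "c \<in> carrier (semidirect n)" "act n c F = H"
      and d: "d \<in> carrier (semidirect n)" "act n d F = G" using orbD[OF H] orbD[OF G] by meson
    have "act n (inv\<^bsub>semidirect n\<^esub> c) H = F" using act.orbit_sym_aux[OF c(1) assms(2) c(2)] .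
    then have "act n (d \<otimes>\<^bsub>semidirect n\<^esub> inv\<^bsub>semidirect n\<^esub> c) H = G"
      using act.composition_rule[OF _ d(1) A.inv_closed[OF c(1)]] orbD[OF H] d(2) by simp
    then show ?thesis using A.m_closed[OF d(1) A.inv_closed[OF c(1)]] by blast
  qed
  have F: "F \<in> ?orb" unfolding Orb_def using act.orbit_refl[OF assms(2)] .

  \<comment> \<open>The element of the semidirect product that carries \<open>H\<close> to \<open>G\<close> conjugates the symmetry of \<open>H\<close> to one
    of \<open>G\<close>; the formula for \<open>\<xi>\<close> is the first component of the conjugate.\<close>
  have all_good: "?good G" if H: "H \<in> ?orb" "self_via n (\<lambda>i\<in>{1..n}. g) \<mu> H" and G: "G \<in> ?orb" for H G
  proof -
    obtain \<gamma> \<pi> where a: "(\<gamma>, \<pi>) \<in> carrier (semidirect n)" "act n (\<gamma>, \<pi>) H = G"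
      using connected[OF H(1) G] by (metis surj_pair)
    then have \<pi>: "\<pi> permutes {1..n}" and \<gamma>: "\<gamma> \<in> extensional {1..n}"
      unfolding semidirect_carrier ops_power_carrier by auto
    let ?\<mu>' = "\<pi> \<circ> \<mu> \<circ> inv' \<pi>"
    define \<xi> where "\<xi> = (\<lambda>i\<in>{1..n}. \<gamma> i \<otimes>\<^bsub>\<SS>\<^esub> g \<otimes>\<^bsub>\<SS>\<^esub> inv\<^bsub>\<SS>\<^esub> \<gamma> (inv' ?\<mu>' i))"
    have "\<xi> (?\<mu>' i) = \<gamma> (?\<mu>' i) \<otimes>\<^bsub>\<SS>\<^esub> g \<otimes>\<^bsub>\<SS>\<^esub> inv\<^bsub>\<SS>\<^esub> \<gamma> i" if "i \<in> {1..n}" for i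
    proof -
      have "?\<mu>' i \<in> {1..n}" using permutes_in_image[OF conj[OF \<pi>]] that by blast
      then show ?thesis
        unfolding \<xi>_def by (simp only: restrict_apply' permutes_inverses(2)[OF conj[OF \<pi>]])
    qed
    then have int: "intertwines n \<gamma> g \<xi> ?\<mu>'"
      by (simp add: intertwines_def S.m_assoc)
    have \<xi>: "\<xi> \<in> carrier (ops_power n)" unfolding ops_power_carrier \<xi>_def by simp
    then have b': "(\<xi>, ?\<mu>') \<in> carrier (semidirect n)"
      using conj[OF \<pi>] unfolding semidirect_carrier by blast
    have "act n (\<xi>, ?\<mu>') G = G"
      using fixed_transport[OF conjunct1[OF orbD[OF H(1)]] a(1) b b' semidirect_intertwine[OF \<gamma> \<pi> \<mu> int]]
        H(2) unfolding self_via_def a(2) by blast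
    moreover have "cycle_ord_property n g \<xi> ?\<mu>'"
      by (rule cycle_ord_if_intertwines[OF conj[OF \<pi>] int])
    moreover have "\<pi> \<in> carrier (sym_group n)" using \<pi> by (simp add: sym_group_carrier)
    ultimately show ?thesis using \<xi> unfolding self_via_def by blast
  qed

  \<comment> \<open>Once \<open>\<gamma>\<close> is found, undoing \<open>(\<gamma>, \<pi>)\<close> on \<open>G\<close> turns its symmetry into the constant one.\<close>
  have self: "\<exists>H\<in>?orb. self_via n (\<lambda>i\<in>{1..n}. g) \<mu> H" if G: "G \<in> ?orb" "?good G" for G
  proof -
    obtain \<xi> \<pi> where \<xi>: "\<xi> \<in> carrier (ops_power n)" and \<pi>': "\<pi> \<in> carrier (sym_group n)"
      and fixed: "act n (\<xi>, \<pi> \<circ> \<mu> \<circ> inv' \<pi>) G = G"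
      and cyc: "cycle_ord_property n g \<xi> (\<pi> \<circ> \<mu> \<circ> inv' \<pi>)"
      using G(2) unfolding self_via_def by blast
    have \<pi>: "\<pi> permutes {1..n}" using \<pi>' by (simp add: sym_group_carrier)
    obtain \<gamma>\<^sub>0 where \<gamma>\<^sub>0: "intertwines n \<gamma>\<^sub>0 g \<xi> (\<pi> \<circ> \<mu> \<circ> inv' \<pi>)"
      using intertwines_if_cycle_ord[OF conj[OF \<pi>] cyc] .
    define \<gamma> where "\<gamma> = restrict \<gamma>\<^sub>0 {1..n}"
    have \<gamma>: "\<gamma> \<in> extensional {1..n}" by (simp add: \<gamma>_def)
    have int: "intertwines n \<gamma> g \<xi> (\<pi> \<circ> \<mu> \<circ> inv' \<pi>)"
      unfolding intertwines_def
    proof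
      fix i assume i: "i \<in> {1..n}"
      then have "(\<pi> \<circ> \<mu> \<circ> inv' \<pi>) i \<in> {1..n}" using permutes_in_image[OF conj[OF \<pi>]] by blast
      with i \<gamma>\<^sub>0 show "\<gamma> ((\<pi> \<circ> \<mu> \<circ> inv' \<pi>) i) \<otimes>\<^bsub>\<SS>\<^esub> g = \<xi> ((\<pi> \<circ> \<mu> \<circ> inv' \<pi>) i) \<otimes>\<^bsub>\<SS>\<^esub> \<gamma> i"
        unfolding intertwines_def \<gamma>_def by (simp only: restrict_apply')
    qed
    have a: "(\<gamma>, \<pi>) \<in> carrier (semidirect n)"
      using \<gamma> \<pi> unfolding semidirect_carrier ops_power_carrier by blast
    have b': "(\<xi>, \<pi> \<circ> \<mu> \<circ> inv' \<pi>) \<in> carrier (semidirect n)"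
      using \<xi> conj[OF \<pi>] unfolding semidirect_carrier by blast
    define H where "H = act n (inv\<^bsub>semidirect n\<^esub> (\<gamma>, \<pi>)) G"
    have H: "H \<in> ?orb" unfolding H_def by (rule orb_act[OF G(1) A.inv_closed[OF a]])
    have "act n (inv\<^bsub>semidirect n\<^esub> (inv\<^bsub>semidirect n\<^esub> (\<gamma>, \<pi>))) H = G"
      using act.orbit_sym_aux[OF A.inv_closed[OF a] conjunct1[OF orbD[OF G(1)]] H_def[symmetric]] .
    then have "act n (\<gamma>, \<pi>) H = G" by (simp only: A.inv_inv[OF a])
    with fixed_transport[OF conjunct1[OF orbD[OF H]] a b b' semidirect_intertwine[OF \<gamma> \<pi> \<mu> int]] fixed
    have "act n ?b H = H" by simp
    with H show ?thesis unfolding self_via_def by blast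
  qed

  show ?thesis
  proof (intro conjI iffI)
    assume "\<exists>H\<in>?orb. self_via n (\<lambda>i\<in>{1..n}. g) \<mu> H"
    then show "\<forall>G\<in>?orb. ?good G" using all_good by blast
  next
    assume "\<forall>G\<in>?orb. ?good G"
    then show "\<exists>H\<in>?orb. self_via n (\<lambda>i\<in>{1..n}. g) \<mu> H" using self[OF F] F by blast
  next
    assume "\<forall>G\<in>?orb. ?good G"
    then show "\<exists>G\<in>?orb. ?good G" using F by blast
  next
    assume "\<exists>G\<in>?orb. ?good G"
    then have "\<exists>H\<in>?orb. self_via n (\<lambda>i\<in>{1..n}. g) \<mu> H" using self by blast
    then show "\<forall>G\<in>?orb. ?good G" using all_good by blast
  qed
qed

end
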